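(* Let $\Omega_2=\mathbb{R}\times(0,1)\subset\mathbb{R}^2$, let $f:\mathbb{R}\to\mathbb{R}$ be a locally Lipschitz continuous function and let $u$ be a bounded $C^2(\overline{\Omega_2})$ solution of the equation $$\Delta u+f(u)=0\quad\text{in }\Omega_2.$$ Suppose that, for some constant $c>0$, $u=0$ on $\{x_2=0\}$, $u=c$ on $\{x_2=1\}$, and $0<u<c$ in $\Omega_2$. Then $u$ is a function of $x_2$ only, that is, $u(x_1,x_2)=\tilde{u}(x_2)$ in $\overline{\Omega_2}$ for some function $\tilde u$ on $[0,1]$, and $\tilde{u}'(x_2)>0$ for all $0<x_2<1$.
   Context: $C^2(\overline{\Omega_2})$ means that all partial derivatives up to order $2$ exist and are continuous up to the boundary (they are not assumed bounded). *)

theory Defs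
  imports "HOL-Analysis.Analysis"
begin

definition line_through :: "(real ^ 'n \<Rightarrow> real) \<Rightarrow> 'n \<Rightarrow> real ^ 'n \<Rightarrow> real \<Rightarrow> real"
  where "line_through u i x = (\<lambda>t. u (x + t *\<^sub>R axis i 1))"

definition partial :: "'n \<Rightarrow> (real ^ 'n \<Rightarrow> real) \<Rightarrow> real ^ 'n \<Rightarrow> real"
  where "partial i u x = deriv (line_through u i x) 0"

definition has_partial_on :: "'n \<Rightarrow> (real ^ 'n \<Rightarrow> real) \<Rightarrow> (real ^ 'n) set \<Rightarrow> bool"
  where "has_partial_on i u S \<longleftrightarrow> (\<forall>x\<in>S. line_through u i x differentiable (at 0))"

definition continuous_up_to_boundary :: "(real ^ 'n) set \<Rightarrow> (real ^ 'n \<Rightarrow> real) \<Rightarrow> bool"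
  where "continuous_up_to_boundary S v \<longleftrightarrow>
    (\<exists>g. continuous_on (closure S) g \<and> (\<forall>x\<in>S. g x = v x))"

text \<open>
  Meant for open \<open>S\<close>: the functions are total, but all derivatives are taken at points of \<open>S\<close>, so
  only the values of \<open>u\<close> on \<open>closure S\<close> matter. For \<open>u\<close> itself, the continuous extension
  is required to be the given \<open>u\<close>, since its boundary values are prescribed.
\<close>

definition C2_on_closure :: "(real ^ 'n) set \<Rightarrow> (real ^ 'n \<Rightarrow> real) \<Rightarrow> bool"
  where "C2_on_closure S u \<longleftrightarrow>
    continuous_on (closure S) u \<and>
    (\<forall>i. has_partial_on i u S \<and> continuous_up_to_boundary S (partial i u)) \<and>
    (\<forall>i j. has_partial_on j (partial i u) S \<and>
      continuous_up_to_boundary S (partial j (partial i u)))"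

definition laplacian :: "(real ^ 'n \<Rightarrow> real) \<Rightarrow> real ^ 'n \<Rightarrow> real"
  where "laplacian u x = (\<Sum>i\<in>UNIV. partial i (partial i u) x)"

text \<open>
  The library's \<^const>\<open>local_lipschitz\<close> is for time-dependent functions; the time is a dummy here.
\<close>

definition locally_lipschitz :: "(real \<Rightarrow> real) \<Rightarrow> bool"
  where "locally_lipschitz f \<longleftrightarrow> local_lipschitz (UNIV :: real set) UNIV (\<lambda>_. f)"

definition strip :: "(real ^ 2) set"
  where "strip = {x. 0 < x $ 2 \<and> x $ 2 < 1}"

end

(*
  The method of moving planes with tilted lines, carried out on compact triangles only, so that no
  compactness at infinity is needed. For a line of slope k > 0 compare u with its reflection on the
  triangle cut out by the line, the bottom of the strip and the reflected top of the strip: the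
  difference is positive on the last two sides and zero on the line. The triangle can be moved
  continuously without losing nonnegativity of the difference, by the strong maximum principle
  and a maximum principle in thin slabs along the line.

  To get started, cut the triangle by the vertical side x1 = 0. For s < s0 suppose that u(0, .) is
  increasing under reflection at height s. Then the difference is positive on the vertical side for
  small k, and sliding the line up from height 0 and letting k tend to 0 gives the reflection
  inequality at height s0 in half the strip; mirror symmetry gives it in the other half, and the strong
  maximum principle and the Hopf lemma make it strict. Hence s0 can be increased up to 1, which
  removes the vertical side for one small slope. Rotating the full triangle until the line is vertical
  shows that u is nonincreasing in x1, and by mirror symmetry u does not depend on x1.
*)
theory Submission
  imports Defs
begin

text \<open>The triangles of a fixed slope k > 0 are translates of one another along the strip, so
  sliding a full triangle never makes it small and offers no starting point. The cut at x1 = 0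
  supplies one: the piece in x1 <= 0 shrinks to a single point at height 0. The price is the sign of
  the difference on the cut, but this concerns one compact vertical segment only, and for small k it
  is a perturbation of the one-dimensional statement that the induction on the height provides.
  Letting the slope tend to 0 turns information on the line x1 = 0 back into an inequality at every
  x1.

  The equation for the difference has a zero-order coefficient of unknown sign, bounded by the
  Lipschitz constant of f. A maximum principle is thus available only for differences already known
  to be nonnegative, or in slabs whose width depends on that constant alone, which keeps the width
  fixed along a whole sweep.

  At the bottom the Hopf lemma can fail, since f(0) may be negative; second derivatives up to the
  boundary replace it.\<close>

section \<open>Second derivatives on lines and the Laplacian\<close>

definition twice_deriv :: "(real \<Rightarrow> real) \<Rightarrow> real \<Rightarrow> bool"
  where "twice_deriv g a \<longleftrightarrow> (\<exists>g'. (\<forall>\<^sub>F t in nhds 0. (g has_real_derivative g' t) (at t)) \<and>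
    (g' has_real_derivative a) (at 0))"

text \<open>Relational rather than functional, so that the minimum test and the rules for sums and
  multiples carry no separate differentiability assumptions. Only the two pure second derivatives at
  the point enter.\<close>

definition has_laplacian :: "(real \<times> real \<Rightarrow> real) \<Rightarrow> real \<times> real \<Rightarrow> real \<Rightarrow> bool"
  where "has_laplacian w x l \<longleftrightarrow> (\<exists>a b. twice_deriv (\<lambda>t. w (fst x + t, snd x)) a \<and>
    twice_deriv (\<lambda>t. w (fst x, snd x + t)) b \<and> l = a + b)"

lemma twice_derivI:
  assumes "\<And>t. (g has_real_derivative g' t) (at t)" "(g' has_real_derivative a) (at 0)"
  shows "twice_deriv g a"
  using assms unfolding twice_deriv_def by (intro exI[of _ g']) auto

lemma twice_deriv_add:
  assumes "twice_deriv g a" "twice_deriv h b"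
  shows "twice_deriv (\<lambda>t. g t + h t) (a + b)"
proof -
  obtain g' h' where
    g: "\<forall>\<^sub>F t in nhds 0. (g has_real_derivative g' t) (at t)" "(g' has_real_derivative a) (at 0)" and
    h: "\<forall>\<^sub>F t in nhds 0. (h has_real_derivative h' t) (at t)" "(h' has_real_derivative b) (at 0)"
    using assms unfolding twice_deriv_def by blast
  have "\<forall>\<^sub>F t in nhds 0. ((\<lambda>t. g t + h t) has_real_derivative (g' t + h' t)) (at t)"
    using g(1) h(1) by eventually_elim (auto intro: DERIV_add)
  moreover have "((\<lambda>t. g' t + h' t) has_real_derivative a + b) (at 0)"
    using g(2) h(2) by (rule DERIV_add)
  ultimately show ?thesis
    unfolding twice_deriv_def by (intro exI[of _ "\<lambda>t. g' t + h' t"]) blast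
qed

lemma twice_deriv_cmult:
  assumes "twice_deriv g a"
  shows "twice_deriv (\<lambda>t. k * g t) (k * a)"
proof -
  obtain g' where
    g: "\<forall>\<^sub>F t in nhds 0. (g has_real_derivative g' t) (at t)" "(g' has_real_derivative a) (at 0)"
    using assms unfolding twice_deriv_def by blast
  have "\<forall>\<^sub>F t in nhds 0. ((\<lambda>t. k * g t) has_real_derivative (k * g' t)) (at t)"
    using g(1) by eventually_elim (auto intro: DERIV_cmult)
  moreover have "((\<lambda>t. k * g' t) has_real_derivative k * a) (at 0)"
    using g(2) by (rule DERIV_cmult)
  ultimately show ?thesis
    unfolding twice_deriv_def by (intro exI[of _ "\<lambda>t. k * g' t"]) blast
qed

text \<open>A negative second derivative at the critical point 0 makes \<open>g'\<close> negative
  just to the right of 0, and by the mean value theorem g would drop below \<open>g 0\<close>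
  there.\<close>

lemma twice_deriv_local_min:
  assumes "twice_deriv g a" and min: "\<forall>\<^sub>F t in nhds 0. g 0 \<le> g t"
  shows "0 \<le> a"
proof (rule ccontr)
  assume "\<not> 0 \<le> a"
  then have a: "a < 0" by simp
  obtain g' where
    g: "\<forall>\<^sub>F t in nhds 0. (g has_real_derivative g' t) (at t)" "(g' has_real_derivative a) (at 0)"
    using assms(1) unfolding twice_deriv_def by blast
  from g(1) min have "\<forall>\<^sub>F t in nhds 0. (g has_real_derivative g' t) (at t) \<and> g 0 \<le> g t"
    by (rule eventually_conj)
  then obtain d where d: "d > 0"
    "\<And>t. \<bar>t\<bar> < d \<Longrightarrow> (g has_real_derivative g' t) (at t)" "\<And>t. \<bar>t\<bar> < d \<Longrightarrow> g 0 \<le> g t"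
    unfolding eventually_nhds_metric dist_real_def by auto
  have g0: "g' 0 = 0"
    using d(1) by (intro DERIV_local_min[OF d(2)[of 0], of d]) (auto intro: d(3))
  obtain e where e: "e > 0" "\<And>h. 0 < h \<Longrightarrow> h < e \<Longrightarrow> g' h < 0"
    using has_real_derivative_neg_dec_right[OF g(2) a] g0 by auto
  define t where "t = min d e / 2"
  have t: "0 < t" "t < d" "t < e" using d(1) e(1) by (auto simp: t_def)
  have "\<exists>z. 0 < z \<and> z < t \<and> g t - g 0 = (t - 0) * g' z"
    using t by (intro MVT2) (auto intro: d(2))
  then obtain z where z: "0 < z" "z < t" "g t - g 0 = t * g' z" by auto
  have "g' z < 0" using z t e(2) by auto
  then have "g t - g 0 < 0" using z(3) t(1) by (simp add: mult_pos_neg)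
  with d(3)[of t] t show False by auto
qed

lemma has_laplacian_add:
  "has_laplacian v x k \<Longrightarrow> has_laplacian w x l \<Longrightarrow> has_laplacian (\<lambda>x. v x + w x) x (k + l)"
  unfolding has_laplacian_def
proof (elim exE conjE)
  fix a b a' b'
  assume "twice_deriv (\<lambda>t. v (fst x + t, snd x)) a" "twice_deriv (\<lambda>t. v (fst x, snd x + t)) b" "k = a + b"
    "twice_deriv (\<lambda>t. w (fst x + t, snd x)) a'" "twice_deriv (\<lambda>t. w (fst x, snd x + t)) b'" "l = a' + b'"
  then show "\<exists>a b. twice_deriv (\<lambda>t. v (fst x + t, snd x) + w (fst x + t, snd x)) a \<and>
      twice_deriv (\<lambda>t. v (fst x, snd x + t) + w (fst x, snd x + t)) b \<and> k + l = a + b"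
    by (intro exI[of _ "a + a'"] exI[of _ "b + b'"]) (auto intro: twice_deriv_add)
qed

lemma has_laplacian_cmult:
  "has_laplacian w x l \<Longrightarrow> has_laplacian (\<lambda>x. k * w x) x (k * l)"
  unfolding has_laplacian_def
  by (force intro: twice_deriv_cmult simp: distrib_left)

lemma has_laplacian_local_min:
  assumes "has_laplacian w x l" and min: "\<forall>\<^sub>F y in nhds x. w x \<le> w y"
  shows "0 \<le> l"
proof -
  obtain a b where ab: "twice_deriv (\<lambda>t. w (fst x + t, snd x)) a"
      "twice_deriv (\<lambda>t. w (fst x, snd x + t)) b" "l = a + b"
    using assms(1) unfolding has_laplacian_def by blast
  have 1: "((\<lambda>t. (fst x + t, snd x)) \<longlongrightarrow> x) (nhds 0)" "((\<lambda>t. (fst x, snd x + t)) \<longlongrightarrow> x) (nhds 0)"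
    by (rule tendsto_eq_intros refl filterlim_ident | simp)+
  have "0 \<le> a"
    using ab(1) eventually_compose_filterlim[OF min 1(1)] by (intro twice_deriv_local_min[OF ab(1)]) simp
  moreover have "0 \<le> b"
    using ab(1) eventually_compose_filterlim[OF min 1(2)] by (intro twice_deriv_local_min[OF ab(2)]) simp
  ultimately show ?thesis using ab by simp
qed

lemma has_laplacian_const: "has_laplacian (\<lambda>x. k) x 0"
  unfolding has_laplacian_def
  by (intro exI[of _ 0] conjI twice_derivI[of _ "\<lambda>_. 0"]) auto

text \<open>The Gaussian around q is the barrier of the Hopf lemma; for \<alpha> > 0 its Laplacian
  is positive as soon as \<open>\<alpha> * s > 1\<close>.\<close>

lemma has_laplacian_gaussian:
  fixes q x :: "real \<times> real"
  defines "s \<equiv> (fst x - fst q)\<^sup>2 + (snd x - snd q)\<^sup>2"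
  shows "has_laplacian (\<lambda>x. exp (- (\<alpha> * ((fst x - fst q)\<^sup>2 + (snd x - snd q)\<^sup>2)))) x
    ((4 * \<alpha>\<^sup>2 * s - 4 * \<alpha>) * exp (- (\<alpha> * s)))"
proof -
  have *: "twice_deriv (\<lambda>t. exp (- (\<alpha> * ((a + t - p)\<^sup>2 + m)))) ((4 * \<alpha>\<^sup>2 * (a - p)\<^sup>2 - 2 * \<alpha>) * exp (- (\<alpha> * ((a - p)\<^sup>2 + m))))"
    for a p m :: real
    by (rule twice_derivI[of _ "\<lambda>t. - 2 * \<alpha> * (a + t - p) * exp (- (\<alpha> * ((a + t - p)\<^sup>2 + m)))"])
       (auto intro!: derivative_eq_intros simp: algebra_simps power2_eq_square)
  have 2: "twice_deriv (\<lambda>t. exp (- (\<alpha> * ((fst x - fst q)\<^sup>2 + (snd x + t - snd q)\<^sup>2))))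
      ((4 * \<alpha>\<^sup>2 * (snd x - snd q)\<^sup>2 - 2 * \<alpha>) * exp (- (\<alpha> * s)))"
    using *[of "snd x" "snd q" "(fst x - fst q)\<^sup>2"] by (simp add: s_def add.commute)
  have 1: "twice_deriv (\<lambda>t. exp (- (\<alpha> * ((fst x + t - fst q)\<^sup>2 + (snd x - snd q)\<^sup>2))))
      ((4 * \<alpha>\<^sup>2 * (fst x - fst q)\<^sup>2 - 2 * \<alpha>) * exp (- (\<alpha> * s)))"
    using * by (simp add: s_def)
  show ?thesis unfolding has_laplacian_def fst_conv snd_conv
    by (intro exI conjI, rule 1, rule 2) (simp add: s_def algebra_simps)
qed

text \<open>The factor \<open>1 + k\<^sup>2\<close> appears because the vertical, not the normal,
  distance to the line is squared.\<close>

lemma has_laplacian_affine_square: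
  "has_laplacian (\<lambda>x. (d + k * fst x - snd x)\<^sup>2) x (2 * (1 + k\<^sup>2))"
proof -
  have 1: "twice_deriv (\<lambda>t. (d + k * (fst x + t) - snd x)\<^sup>2) (2 * k\<^sup>2)"
    by (rule twice_derivI[of _ "\<lambda>t. 2 * k * (d + k * (fst x + t) - snd x)"])
       (auto intro!: derivative_eq_intros simp: algebra_simps power2_eq_square)
  have 2: "twice_deriv (\<lambda>t. (d + k * fst x - (snd x + t))\<^sup>2) 2"
    by (rule twice_derivI[of _ "\<lambda>t. - 2 * (d + k * fst x - (snd x + t))"])
       (auto intro!: derivative_eq_intros simp: algebra_simps power2_eq_square)
  show ?thesis unfolding has_laplacian_def fst_conv snd_conv
    by (rule exI[of _ "2 * k\<^sup>2"], rule exI[of _ 2]) (use 1 2 in \<open>auto simp: algebra_simps\<close>)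
qed

section \<open>The Hopf lemma and the strong maximum principle\<close>

text \<open>Barrier argument in the annulus between the radii r/2 and r: w dominates a multiple of a
  Gaussian minus its value on the outer circle, and that function vanishes linearly at radius r. As
  w is nonnegative, a bounded zero-order coefficient of either sign can be weakened to
  \<open>L * w\<close>.\<close>

lemma hopf:
  fixes w :: "real \<times> real \<Rightarrow> real"
  assumes r: "r > 0" and L: "L \<ge> 0"
    and cont: "continuous_on (cball q r) w"
    and nonneg: "\<And>x. x \<in> cball q r \<Longrightarrow> w x \<ge> 0"
    and super: "\<And>x. x \<in> ball q r \<Longrightarrow> \<exists>l. has_laplacian w x l \<and> l \<le> L * w x"
    and pos: "\<And>x. x \<in> cball q (r / 2) \<Longrightarrow> w x > 0"
  shows "\<exists>\<kappa>>0. \<forall>x. r / 2 \<le> dist q x \<longrightarrow> dist q x \<le> r \<longrightarrow> w x \<ge> \<kappa> * (r - dist q x)"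
proof -
  \<comment> \<open>Chosen so that \<open>\<alpha>\<^sup>2 * r\<^sup>2 - 4 * \<alpha> \<ge> \<alpha>
    * L \<ge> L\<close>: outside radius r/2 the Laplacian of the Gaussian then exceeds L times the
    Gaussian.\<close>
  define \<alpha> where "\<alpha> = (4 + L) / r\<^sup>2 + 1"
  have \<alpha>: "\<alpha> \<ge> 1" "\<alpha> * r\<^sup>2 \<ge> 4 + L" using r L by (auto simp: \<alpha>_def field_simps)
  define E where "E = (\<lambda>x :: real \<times> real. exp (- (\<alpha> * ((fst x - fst q)\<^sup>2 + (snd x - snd q)\<^sup>2))))"
  define E0 where "E0 = exp (- (\<alpha> * r\<^sup>2))"
  have dsq: "(fst x - fst q)\<^sup>2 + (snd x - snd q)\<^sup>2 = (dist q x)\<^sup>2" for x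
    by (cases x, cases q) (simp add: dist_Pair_Pair dist_real_def power2_commute)
  have E_dist: "E x = exp (- (\<alpha> * (dist q x)\<^sup>2))" for x by (simp add: E_def dsq)
  have E1: "E x \<le> 1" for x using \<alpha> by (simp add: E_def)
  have contE: "continuous_on A E" for A unfolding E_def by (intro continuous_intros)
  have E0: "E0 > 0" by (simp add: E0_def)
  obtain m where m: "m > 0" "\<And>x. x \<in> cball q (r/2) \<Longrightarrow> m \<le> w x"
  proof -
    have "continuous_on (cball q (r/2)) w" using r by (intro continuous_on_subset[OF cont]) auto
    then obtain z where "z \<in> cball q (r/2)" "\<And>x. x \<in> cball q (r/2) \<Longrightarrow> w z \<le> w x"
      using r continuous_attains_inf[of "cball q (r/2)" w] by (auto simp del: mem_cball)
    then show ?thesis using pos that[of "w z"] by auto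
  qed
  define A where "A = cball q r - ball q (r/2)"
  have "compact A" unfolding A_def by (intro compact_diff compact_cball open_ball)
  define \<phi> where "\<phi> = (\<lambda>x. w x + (- m) * E x + m * E0)"
  have \<phi>: "\<phi> x \<ge> 0" if xA: "x \<in> A" for x
  proof (rule ccontr)
    assume neg: "\<not> \<phi> x \<ge> 0"
    have "continuous_on A \<phi>" unfolding \<phi>_def
      by (intro continuous_intros contE continuous_on_subset[OF cont]) (auto simp: A_def)
    then obtain z where z: "z \<in> A" "\<And>y. y \<in> A \<Longrightarrow> \<phi> z \<le> \<phi> y"
      using continuous_attains_inf[OF \<open>compact A\<close> _ \<open>continuous_on A \<phi>\<close>] xA by (metis empty_iff)
    have z0: "\<phi> z < 0" using z(2)[OF xA] neg by auto
    have "dist q z \<noteq> r"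
    proof
      assume "dist q z = r"
      then have "\<phi> z = w z" by (simp add: \<phi>_def E_dist E0_def)
      then show False using z0 nonneg[of z] z(1) by (auto simp: A_def)
    qed
    moreover have "dist q z \<noteq> r/2"
    proof
      assume "dist q z = r/2"
      then have "m \<le> w z" using m(2)[of z] by simp
      moreover have "m * E z \<le> m * 1" using E1 m(1) by (intro mult_left_mono) auto
      moreover have "m * E0 > 0" using m E0 by simp
      ultimately have "\<phi> z > 0" unfolding \<phi>_def by simp
      then show False using z0 by simp
    qed
    ultimately have zi: "r/2 < dist q z" "dist q z < r" using z(1) by (auto simp: A_def)
    have "open (ball q r - cball q (r/2))" by (intro open_Diff open_ball closed_cball)
    moreover have "z \<in> ball q r - cball q (r/2)" using zi by auto
    ultimately have "\<forall>\<^sub>F y in nhds z. y \<in> ball q r - cball q (r/2)" by (rule eventually_nhds_in_open)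
    then have ev: "\<forall>\<^sub>F y in nhds z. \<phi> z \<le> \<phi> y"
      by eventually_elim (intro z(2), auto simp: A_def)
    obtain l where l: "has_laplacian w z l" "l \<le> L * w z" using super[of z] zi by auto
    define lE where "lE = (4 * \<alpha>\<^sup>2 * (dist q z)\<^sup>2 - 4 * \<alpha>) * E z"
    have lE: "has_laplacian E z lE" using has_laplacian_gaussian[of \<alpha> q z]
      unfolding E_def lE_def dsq by simp
    have "has_laplacian \<phi> z (l + (- m) * lE + 0)" unfolding \<phi>_def
      by (intro has_laplacian_add has_laplacian_cmult has_laplacian_const l lE)
    then have "0 \<le> l + (- m) * lE + 0" using ev by (rule has_laplacian_local_min)
    \<comment> \<open>At a negative value of \<phi>, \<open>w z\<close> lies below
      \<open>m * (E z - E0)\<close>. The term E0 yields the contradiction when L > 0; when L = 0 the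
      strict inequality r/2 < dist q z decides.\<close>
    then have "m * lE \<le> L * w z" using l(2) by simp
    also have "\<dots> \<le> L * (m * (E z - E0))"
      using z0 L by (intro mult_left_mono) (auto simp: \<phi>_def algebra_simps)
    also have "\<dots> = m * (L * (E z - E0))" by simp
    finally have 1: "lE \<le> L * (E z - E0)" using m(1) by (simp add: mult_le_cancel_left_pos)
    have "(r/2)\<^sup>2 < (dist q z)\<^sup>2" using zi r by (intro power_strict_mono) auto
    then have "4 * \<alpha>\<^sup>2 * (r/2)\<^sup>2 < 4 * \<alpha>\<^sup>2 * (dist q z)\<^sup>2" using \<alpha> by simp
    moreover have "\<alpha> * (\<alpha> * r\<^sup>2) \<ge> \<alpha> * (4 + L)" using \<alpha> by (intro mult_left_mono) auto
    moreover have "\<alpha> * L \<ge> 1 * L" using \<alpha> L by (intro mult_right_mono) auto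
    ultimately have "4 * \<alpha>\<^sup>2 * (dist q z)\<^sup>2 - 4 * \<alpha> \<ge> L" by (simp add: power2_eq_square algebra_simps)
    then have "lE \<ge> L * E z" unfolding lE_def by (intro mult_right_mono) (auto simp: E_def)
    with 1 have "L * E0 \<le> 0" by (simp add: algebra_simps)
    then have "L = 0" using L E0 by (simp add: mult_le_0_iff)
    with 1 have "lE \<le> 0" by simp
    moreover have "lE > 0"
    proof -
      have "4 * \<alpha>\<^sup>2 * (dist q z)\<^sup>2 - 4 * \<alpha> > 0"
        using \<open>4 * \<alpha>\<^sup>2 * (r/2)\<^sup>2 < 4 * \<alpha>\<^sup>2 * (dist q z)\<^sup>2\<close> \<open>\<alpha> * (\<alpha> * r\<^sup>2) \<ge> \<alpha> * (4 + L)\<close> \<open>L = 0\<close>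
        by (simp add: power2_eq_square algebra_simps)
      then show ?thesis unfolding lE_def by (simp add: E_def)
    qed
    ultimately show False by simp
  qed
  \<comment> \<open>The rate comes from \<open>exp s \<ge> 1 + s\<close> applied to the quotient E /
    E0, together with \<open>r\<^sup>2 - \<rho>\<^sup>2 \<ge> r * (r - \<rho>)\<close>.\<close>
  define \<kappa> where "\<kappa> = m * (E0 * (\<alpha> * r))"
  have "\<kappa> > 0" using m E0 \<alpha> r by (simp add: \<kappa>_def)
  moreover have "w x \<ge> \<kappa> * (r - dist q x)" if "r / 2 \<le> dist q x" "dist q x \<le> r" for x
  proof -
    define \<rho> where "\<rho> = dist q x"
    have "x \<in> A" using that by (auto simp: A_def)
    from \<phi>[OF this] have "w x \<ge> m * (E x - E0)" by (simp add: \<phi>_def algebra_simps)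
    moreover have "E x - E0 \<ge> E0 * (\<alpha> * r) * (r - \<rho>)"
    proof -
      have "E x = E0 * exp (\<alpha> * (r\<^sup>2 - \<rho>\<^sup>2))"
        by (simp add: E_dist E0_def \<rho>_def algebra_simps flip: exp_add)
      also have "\<dots> \<ge> E0 * (1 + \<alpha> * (r\<^sup>2 - \<rho>\<^sup>2))" using E0 exp_ge_add_one_self by (intro mult_left_mono) auto
      finally have "E x - E0 \<ge> E0 * (\<alpha> * (r\<^sup>2 - \<rho>\<^sup>2))" by (simp add: algebra_simps)
      moreover have "r\<^sup>2 - \<rho>\<^sup>2 \<ge> r * (r - \<rho>)"
      proof -
        have "r\<^sup>2 - \<rho>\<^sup>2 - r * (r - \<rho>) = \<rho> * (r - \<rho>)" by (simp add: power2_eq_square algebra_simps)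
        moreover have "\<rho> * (r - \<rho>) \<ge> 0" using that by (simp add: \<rho>_def)
        ultimately show ?thesis by linarith
      qed
      then have "E0 * (\<alpha> * (r\<^sup>2 - \<rho>\<^sup>2)) \<ge> E0 * (\<alpha> * (r * (r - \<rho>)))" using E0 \<alpha> by (intro mult_left_mono) auto
      ultimately show ?thesis by (simp add: mult.assoc)
    qed
    then have "m * (E x - E0) \<ge> m * (E0 * (\<alpha> * r) * (r - \<rho>))" using m by (intro mult_left_mono) auto
    ultimately show ?thesis by (simp add: \<kappa>_def \<rho>_def mult.assoc)
  qed
  ultimately show ?thesis by blast
qed

text \<open>Were the zero set not open, a disc free of zeros would touch it at a point p of U. There
  w has a minimum, so its directional derivatives vanish, while the Hopf lemma forces linear growth
  into the disc. Connectedness does the rest.\<close>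

lemma strong_maximum_principle:
  fixes w :: "real \<times> real \<Rightarrow> real"
  assumes U: "open U" "connected U" and L: "L \<ge> 0"
    and diff: "\<And>x. x \<in> U \<Longrightarrow> w differentiable (at x)"
    and super: "\<And>x. x \<in> U \<Longrightarrow> \<exists>l. has_laplacian w x l \<and> l \<le> L * w x"
    and nonneg: "\<And>x. x \<in> U \<Longrightarrow> w x \<ge> 0"
    and z: "z \<in> U" "w z = 0"
    and x: "x \<in> U"
  shows "w x = 0"
proof -
  define Z where "Z = {x \<in> U. w x = 0}"
  have cont: "continuous_on U w"
    by (intro continuous_at_imp_continuous_on ballI differentiable_imp_continuous_within diff)
  have Zc: "closedin (top_of_set U) Z"
    unfolding Z_def by (rule continuous_closedin_preimage_constant[OF cont])
  have "open Z"
  proof (rule ccontr)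
    assume "\<not> open Z"
    then obtain a where a: "a \<in> Z" "\<And>e. e > 0 \<Longrightarrow> \<not> ball a e \<subseteq> Z"
      unfolding open_contains_ball by blast
    then have "a \<in> U" by (simp add: Z_def)
    then obtain e where e: "e > 0" "cball a e \<subseteq> U" using U(1) unfolding open_contains_cball by blast
    \<comment> \<open>With q closer to a than e/2, the disc around q through the nearest zero stays
      inside \<open>cball a e\<close>, since a itself is a zero.\<close>
    have "\<not> ball a (e/2) \<subseteq> Z" using a(2) e by simp
    then obtain q where q: "dist a q < e/2" "q \<notin> Z" unfolding subset_iff mem_ball by blast
    have "compact (Z \<inter> cball a e)"
    proof -
      have "Z \<inter> cball a e = {x \<in> cball a e. w x = 0}" using e by (auto simp: Z_def)
      moreover have "closed {x \<in> cball a e. w x = 0}"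
        by (intro continuous_closed_preimage_constant continuous_on_subset[OF cont] e closed_cball)
      ultimately show ?thesis
        by (metis (no_types, lifting) bounded_cball bounded_subset compact_eq_bounded_closed mem_Collect_eq subsetI)
    qed
    moreover have "a \<in> Z \<inter> cball a e" using a e by simp
    ultimately obtain p where p: "p \<in> Z \<inter> cball a e" "\<And>y. y \<in> Z \<inter> cball a e \<Longrightarrow> dist q p \<le> dist q y"
      using distance_attains_inf[of "Z \<inter> cball a e" q] compact_imp_closed by blast
    define r where "r = dist q p"
    have r: "r \<le> dist a q" using p(2)[OF \<open>a \<in> Z \<inter> cball a e\<close>] by (simp add: r_def dist_commute)
    have r0: "r > 0" using p(1) q(2) by (auto simp: r_def)
    have sub: "cball q r \<subseteq> cball a e"
    proof
      fix y assume "y \<in> cball q r"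
      then show "y \<in> cball a e" using dist_triangle[of a y q] r q by auto
    qed
    have wpos: "w y > 0" if "y \<in> ball q r" for y
    proof -
      have "y \<in> cball a e" using subsetD[OF sub, of y] that by simp
      then have "y \<notin> Z" using p(2)[of y] that by (auto simp: r_def)
      then show ?thesis using \<open>y \<in> cball a e\<close> e nonneg[of y] by (force simp: Z_def)
    qed
    obtain \<kappa> where \<kappa>: "\<kappa> > 0"
      "\<And>x. r / 2 \<le> dist q x \<Longrightarrow> dist q x \<le> r \<Longrightarrow> w x \<ge> \<kappa> * (r - dist q x)"
    proof -
      have "\<exists>\<kappa>>0. \<forall>x. r / 2 \<le> dist q x \<longrightarrow> dist q x \<le> r \<longrightarrow> w x \<ge> \<kappa> * (r - dist q x)"
      proof (rule hopf[OF r0 L])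
        show "continuous_on (cball q r) w" using sub e by (intro continuous_on_subset[OF cont]) auto
        show "w x \<ge> 0" if "x \<in> cball q r" for x using that sub e(2) by (intro nonneg) blast
        show "\<exists>l. has_laplacian w x l \<and> l \<le> L * w x" if "x \<in> ball q r" for x
          using that sub e(2) ball_subset_cball by (intro super) blast
        show "w x > 0" if "x \<in> cball q (r / 2)" for x using that r0 by (intro wpos) auto
      qed
      then show ?thesis using that by blast
    qed
    have pU: "p \<in> U" "w p = 0" using p by (auto simp: Z_def)
    then obtain w' where w': "(w has_derivative w') (at p)" using diff unfolding differentiable_def by blast
    define g where "g = (\<lambda>t. w (p + t *\<^sub>R (q - p)))"
    have g': "(g has_real_derivative (w' (q - p))) (at 0)"
    proof -
      have "((\<lambda>t. p + t *\<^sub>R (q - p)) has_derivative (\<lambda>t. t *\<^sub>R (q - p))) (at 0)"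
        by (auto intro!: derivative_eq_intros)
      then have "((\<lambda>t. w (p + t *\<^sub>R (q - p))) has_derivative (\<lambda>t. w' (t *\<^sub>R (q - p)))) (at 0)"
        using has_derivative_compose[of "\<lambda>t. p + t *\<^sub>R (q - p)" _ 0 UNIV w w'] w' by simp
      moreover have "w' (t *\<^sub>R (q - p)) = w' (q - p) * t" for t
        using has_derivative_linear[OF w'] by (simp add: linear_cmul)
      ultimately show ?thesis unfolding has_field_derivative_def g_def by simp
    qed
    have ev: "\<forall>\<^sub>F t in nhds 0. p + t *\<^sub>R (q - p) \<in> U"
    proof -
      have "((\<lambda>t. p + t *\<^sub>R (q - p)) \<longlongrightarrow> p) (nhds 0)"
        by (rule tendsto_eq_intros refl filterlim_ident | simp)+
      then show ?thesis using U(1) pU(1) by (rule topological_tendstoD)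
    qed
    then obtain d where d: "d > 0" "\<And>t. \<bar>t\<bar> < d \<Longrightarrow> p + t *\<^sub>R (q - p) \<in> U"
      unfolding eventually_nhds_metric dist_real_def by auto
    have "w' (q - p) = 0"
      using d(1) pU by (intro DERIV_local_min[OF g' d(1)]) (auto simp: g_def intro!: nonneg d(2))
    with g' have g0: "(g has_real_derivative 0) (at 0)" by simp
    \<comment> \<open>Along the radius g has derivative 0 at p but is at least
      \<open>\<kappa> * r * t\<close>; subtracting this line leaves a function with negative
      derivative at 0.\<close>
    have "\<kappa> * r > 0" using \<kappa> r0 by simp
    then have "((\<lambda>t. g t - \<kappa> * r * t) has_real_derivative - (\<kappa> * r)) (at 0)"
      using g0 by (auto intro!: derivative_eq_intros)
    then obtain d' where d': "d' > 0" "\<And>h. h > 0 \<Longrightarrow> h < d' \<Longrightarrow> g h - \<kappa> * r * h < g 0"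
      using has_real_derivative_neg_dec_right[of "\<lambda>t. g t - \<kappa> * r * t" "- (\<kappa> * r)" 0 UNIV]
        \<open>\<kappa> * r > 0\<close> by auto
    define h where "h = min (d'/2) (1/2)"
    have h: "0 < h" "h < d'" "h \<le> 1/2" using d' by (auto simp: h_def)
    have "dist q (p + h *\<^sub>R (q - p)) = norm ((1 - h) *\<^sub>R (q - p))"
      by (simp add: dist_norm algebra_simps)
    then have dh: "dist q (p + h *\<^sub>R (q - p)) = (1 - h) * r" using h by (simp add: r_def dist_norm)
    have "h * r \<le> (1/2) * r" using h r0 by (intro mult_right_mono) auto
    then have "r / 2 \<le> (1 - h) * r" "(1 - h) * r \<le> r" using h r0 by (auto simp: left_diff_distrib)
    then have "g h \<ge> \<kappa> * (r - (1 - h) * r)"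
      unfolding g_def by (intro \<kappa>(2)[of "p + h *\<^sub>R (q - p)", unfolded dh])
    then have "g h \<ge> \<kappa> * r * h" by (simp add: algebra_simps)
    then show False using d'(2)[of h] h pU(2) by (simp add: g_def)
  qed
  then have "openin (top_of_set U) Z" using U(1) by (simp add: openin_open_eq Z_def)
  then have "Z = {} \<or> Z = U" using U(2) Zc unfolding connected_clopen by blast
  moreover have "z \<in> Z" using z by (simp add: Z_def)
  ultimately have "x \<in> Z" using x by blast
  then show ?thesis by (simp add: Z_def)
qed

section \<open>Reflection in a line\<close>

text \<open>
  Lines are \<open>x\<^sub>2 = k x\<^sub>1 + d\<close>; \<open>gap\<close> is the signed vertical distance up to the line.
\<close>

definition gap :: "real \<Rightarrow> real \<Rightarrow> real \<times> real \<Rightarrow> real"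
  where "gap k d x = d + k * fst x - snd x"

text \<open>\<open>gap k d x / (1 + k\<^sup>2)\<close> is the multiple of the normal (-k, 1) that
  leads from x to the line; doubling it reflects.\<close>

definition refl_line :: "real \<Rightarrow> real \<Rightarrow> real \<times> real \<Rightarrow> real \<times> real"
  where "refl_line k d x = (fst x - 2 * k * gap k d x / (1 + k\<^sup>2), snd x + 2 * gap k d x / (1 + k\<^sup>2))"

text \<open>The condition on the image places x on the near side of the reflected top line without
  writing down that line. The limit case k = 0, an unbounded horizontal strip, is covered by the
  same formula.\<close>

definition cap :: "real \<Rightarrow> real \<Rightarrow> (real \<times> real) set"
  where "cap k d = {x. 0 \<le> snd x \<and> 0 \<le> gap k d x \<and> snd (refl_line k d x) \<le> 1}"

definition cap_interior :: "real \<Rightarrow> real \<Rightarrow> (real \<times> real) set"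
  where "cap_interior k d = {x. 0 < snd x \<and> 0 < gap k d x \<and> snd (refl_line k d x) < 1}"

lemma one_plus_square_pos: "1 + k\<^sup>2 > (0::real)"
  by (simp add: add_pos_nonneg)

lemma one_plus_square_neq_0: "1 + k\<^sup>2 \<noteq> (0::real)"
  using one_plus_square_pos[of k] by simp

lemma continuous_on_gap [continuous_intros]:
  "continuous_on A k \<Longrightarrow> continuous_on A d \<Longrightarrow> continuous_on A x \<Longrightarrow>
    continuous_on A (\<lambda>t. gap (k t) (d t) (x t))"
  unfolding gap_def by (intro continuous_intros)

lemma continuous_on_refl_line [continuous_intros]:
  "continuous_on A k \<Longrightarrow> continuous_on A d \<Longrightarrow> continuous_on A x \<Longrightarrow>
    continuous_on A (\<lambda>t. refl_line (k t) (d t) (x t))"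
  unfolding refl_line_def by (intro continuous_intros) (auto simp: one_plus_square_neq_0)

lemma tendsto_gap [tendsto_intros]:
  "(k \<longlongrightarrow> k0) F \<Longrightarrow> (d \<longlongrightarrow> d0) F \<Longrightarrow> (x \<longlongrightarrow> x0) F \<Longrightarrow>
    ((\<lambda>t. gap (k t) (d t) (x t)) \<longlongrightarrow> gap k0 d0 x0) F"
  unfolding gap_def by (intro tendsto_intros)

lemma tendsto_refl_line [tendsto_intros]:
  "(k \<longlongrightarrow> k0) F \<Longrightarrow> (d \<longlongrightarrow> d0) F \<Longrightarrow> (x \<longlongrightarrow> x0) F \<Longrightarrow>
    ((\<lambda>t. refl_line (k t) (d t) (x t)) \<longlongrightarrow> refl_line k0 d0 x0) F"
  unfolding refl_line_def by (intro tendsto_intros) (auto simp: one_plus_square_neq_0)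

text \<open>Points under the line are reflected upwards, so a lower bound for x and an upper bound
  for its image confine both to the closed strip.\<close>

lemma cap_snd:
  assumes "x \<in> cap k d"
  shows "0 \<le> snd x" "snd x \<le> 1" "0 \<le> snd (refl_line k d x)" "snd (refl_line k d x) \<le> 1"
proof -
  have "snd (refl_line k d x) \<ge> snd x"
    using assms one_plus_square_pos[of k] by (simp add: cap_def refl_line_def)
  then show "0 \<le> snd x" "snd x \<le> 1" "0 \<le> snd (refl_line k d x)" "snd (refl_line k d x) \<le> 1"
    using assms by (auto simp: cap_def)
qed

lemma cap_interior_snd:
  assumes "x \<in> cap_interior k d"
  shows "0 < snd x" "snd x < 1" "0 < snd (refl_line k d x)" "snd (refl_line k d x) < 1"
proof -
  have "snd (refl_line k d x) > snd x"
    using assms one_plus_square_pos[of k] by (simp add: cap_interior_def refl_line_def)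
  then show "0 < snd x" "snd x < 1" "0 < snd (refl_line k d x)" "snd (refl_line k d x) < 1"
    using assms by (auto simp: cap_interior_def)
qed

lemma cap_interior_subset: "cap_interior k d \<subseteq> cap k d"
  by (auto simp: cap_def cap_interior_def)

lemma refl_line_gap_0: "gap k d x = 0 \<Longrightarrow> refl_line k d x = x"
  by (simp add: refl_line_def)

lemma open_cap_interior: "open (cap_interior k d)"
proof -
  have "cap_interior k d = {x. 0 < snd x} \<inter> {x. 0 < gap k d x} \<inter> {x. snd (refl_line k d x) < 1}"
    by (auto simp: cap_interior_def)
  then show ?thesis by (auto intro!: open_Collect_less open_Int continuous_intros)
qed

lemma gap_affine: "u + v = 1 \<Longrightarrow> gap k d (u *\<^sub>R x + v *\<^sub>R y) = u * gap k d x + v * gap k d y"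
proof -
  assume "u + v = 1"
  then have "u = 1 - v" by simp
  show ?thesis unfolding \<open>u = 1 - v\<close> by (simp add: gap_def algebra_simps)
qed

lemma snd_refl_line_affine:
  assumes "u + v = 1"
  shows "snd (refl_line k d (u *\<^sub>R x + v *\<^sub>R y)) = u * snd (refl_line k d x) + v * snd (refl_line k d y)"
  unfolding refl_line_def snd_conv gap_affine[OF assms] by (simp add: algebra_simps add_divide_distrib)

lemma affine_gt:
  fixes a b l u v :: real
  assumes "a > l" "b > l" "u \<ge> 0" "v \<ge> 0" "u + v = 1"
  shows "u * a + v * b > l"
  using convex_bound_lt[of "- a" "- l" "- b" u v] assms by simp

text \<open>An intersection of three open half planes, since the height of the image is affine.
  Convexity supplies the connectedness for the strong maximum principle.\<close>

lemma convex_cap_interior: "convex (cap_interior k d)"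
proof (rule convexI)
  fix x y :: "real \<times> real" and u v :: real
  assume *: "x \<in> cap_interior k d" "y \<in> cap_interior k d" "0 \<le> u" "0 \<le> v" "u + v = 1"
  then show "u *\<^sub>R x + v *\<^sub>R y \<in> cap_interior k d"
    unfolding cap_interior_def mem_Collect_eq gap_affine[OF *(5)] snd_refl_line_affine[OF *(5)]
    by (auto intro: affine_gt convex_bound_lt)
qed

lemma compact_cap:
  assumes "k > 0"
  shows "compact (cap k d \<inter> {x. fst x \<le> b})"
proof -
  have "cap k d \<inter> {x. fst x \<le> b} =
      {x. 0 \<le> snd x} \<inter> {x. 0 \<le> gap k d x} \<inter> {x. snd (refl_line k d x) \<le> 1} \<inter> {x. fst x \<le> b}"
    by (auto simp: cap_def)
  then have "closed (cap k d \<inter> {x. fst x \<le> b})"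
    by (auto intro!: closed_Collect_le closed_Int continuous_intros)
  moreover have "cap k d \<inter> {x. fst x \<le> b} \<subseteq> cbox (- d / k, 0) (b, 1)"
  proof
    fix x assume x: "x \<in> cap k d \<inter> {x. fst x \<le> b}"
    have "k * fst x \<ge> - d" using x by (auto simp: cap_def gap_def)
    then have "fst x \<ge> - d / k" using assms by (simp add: field_simps)
    then show "x \<in> cbox (- d / k, 0) (b, 1)" using x cap_snd[of x k d]
      by (cases x) (auto simp: cbox_Pair_iff)
  qed
  ultimately show ?thesis
    using bounded_cbox bounded_subset compact_eq_bounded_closed by blast
qed

lemma has_derivative_along_line:
  fixes F :: "real \<times> real \<Rightarrow> real"
  assumes "(F has_derivative (\<lambda>h. A * fst h + B * snd h)) (at (a + t * p, b + t * q))"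
  shows "((\<lambda>t. F (a + t * p, b + t * q)) has_real_derivative (A * p + B * q)) (at t)"
proof -
  have d: "((\<lambda>t. (a + t * p, b + t * q)) has_derivative (\<lambda>h. (h * p, h * q))) (at t)"
    by (auto intro!: derivative_eq_intros)
  have "(\<lambda>h. A * fst (h * p, h * q) + B * snd (h * p, h * q)) = (*) (A * p + B * q)"
    by (simp add: fun_eq_iff algebra_simps)
  with has_derivative_compose[OF d assms] show ?thesis
    unfolding has_field_derivative_def by simp
qed

text \<open>Gradient and Hessian entries are parameters, continuous on the closed strip, so that
  boundary values can be used although derivatives are taken inside. As a locale the setting can be
  instantiated again with the solution turned upside down or mirrored. L is a Lipschitz constant of
  f on [0, c], which contains the range of u; L > 0 allows division by it.\<close>

locale strip_solution =
  fixes f :: "real \<Rightarrow> real" and c L :: real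
    and u g1 g2 g11 g12 g21 g22 :: "real \<times> real \<Rightarrow> real"
  assumes cont: "continuous_on (UNIV \<times> {0..1}) u"
      "continuous_on (UNIV \<times> {0..1}) g1" "continuous_on (UNIV \<times> {0..1}) g2"
      "continuous_on (UNIV \<times> {0..1}) g11" "continuous_on (UNIV \<times> {0..1}) g12"
      "continuous_on (UNIV \<times> {0..1}) g21" "continuous_on (UNIV \<times> {0..1}) g22"
    and deriv_u: "\<And>x. 0 < snd x \<Longrightarrow> snd x < 1 \<Longrightarrow> (u has_derivative (\<lambda>h. g1 x * fst h + g2 x * snd h)) (at x)"
    and deriv_g1: "\<And>x. 0 < snd x \<Longrightarrow> snd x < 1 \<Longrightarrow> (g1 has_derivative (\<lambda>h. g11 x * fst h + g12 x * snd h)) (at x)"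
    and deriv_g2: "\<And>x. 0 < snd x \<Longrightarrow> snd x < 1 \<Longrightarrow> (g2 has_derivative (\<lambda>h. g21 x * fst h + g22 x * snd h)) (at x)"
    and pde: "\<And>x. 0 < snd x \<Longrightarrow> snd x < 1 \<Longrightarrow> g11 x + g22 x + f (u x) = 0"
    and lipschitz: "\<And>a b. a \<in> {0..c} \<Longrightarrow> b \<in> {0..c} \<Longrightarrow> \<bar>f a - f b\<bar> \<le> L * \<bar>a - b\<bar>"
    and L_pos: "L > 0" and c_pos: "c > 0"
    and bottom: "\<And>a. u (a, 0) = 0" and top: "\<And>a. u (a, 1) = c"
    and range: "\<And>x. 0 < snd x \<Longrightarrow> snd x < 1 \<Longrightarrow> 0 < u x \<and> u x < c"
begin

lemma range_closed: "0 \<le> snd x \<Longrightarrow> snd x \<le> 1 \<Longrightarrow> 0 \<le> u x \<and> u x \<le> c"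
  using range[of x] bottom[of "fst x"] top[of "fst x"] c_pos
  by (cases "snd x = 0"; cases "snd x = 1"; cases x) auto

lemma u_pos: "0 < snd x \<Longrightarrow> snd x \<le> 1 \<Longrightarrow> 0 < u x"
  using range[of x] top[of "fst x"] c_pos by (cases "snd x = 1"; cases x) auto

lemma u_less: "0 \<le> snd x \<Longrightarrow> snd x < 1 \<Longrightarrow> u x < c"
  using range[of x] bottom[of "fst x"] c_pos by (cases "snd x = 0"; cases x) auto

lemma twice_deriv_along_line:
  assumes "0 < b" "b < 1"
  shows "twice_deriv (\<lambda>t. u (a + t * p, b + t * q))
    (g11 (a, b) * p\<^sup>2 + (g12 (a, b) + g21 (a, b)) * (p * q) + g22 (a, b) * q\<^sup>2)"
proof -
  have "((\<lambda>t. b + t * q) \<longlongrightarrow> b) (nhds 0)" by (rule tendsto_eq_intros refl filterlim_ident | simp)+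
  from order_tendstoD[OF this] have "\<forall>\<^sub>F t in nhds 0. 0 < b + t * q" "\<forall>\<^sub>F t in nhds 0. b + t * q < 1"
    using assms by auto
  then have "\<forall>\<^sub>F t in nhds 0. ((\<lambda>t. u (a + t * p, b + t * q)) has_real_derivative
      (g1 (a + t * p, b + t * q) * p + g2 (a + t * p, b + t * q) * q)) (at t)"
    by eventually_elim (intro has_derivative_along_line deriv_u; simp)
  moreover have "((\<lambda>t. g1 (a + t * p, b + t * q) * p + g2 (a + t * p, b + t * q) * q) has_real_derivative
      (g11 (a, b) * p + g12 (a, b) * q) * p + (g21 (a, b) * p + g22 (a, b) * q) * q) (at 0)"
    using deriv_g1[of "(a, b)"] deriv_g2[of "(a, b)"] assms
    by (intro DERIV_add DERIV_cmult_right has_derivative_along_line) auto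
  ultimately show ?thesis
    unfolding twice_deriv_def
    by (intro exI[of _ "\<lambda>t. g1 (a + t * p, b + t * q) * p + g2 (a + t * p, b + t * q) * q"])
      (simp add: algebra_simps power2_eq_square)
qed

lemma has_laplacian_u:
  assumes "0 < snd x" "snd x < 1"
  shows "has_laplacian u x (- f (u x))"
proof -
  have "has_laplacian u x (g11 x + g22 x)"
    unfolding has_laplacian_def
    using twice_deriv_along_line[OF assms, of "fst x" 1 0] twice_deriv_along_line[OF assms, of "fst x" 0 1]
    by (intro exI[of _ "g11 x"] exI[of _ "g22 x"]) simp
  moreover have "g11 x + g22 x = - f (u x)" using pde[OF assms] by simp
  ultimately show ?thesis by simp
qed

text \<open>The reflection is an isometry: it sends the axis directions to the orthonormal pair (p,
  q), (q, -p), and the mixed second derivatives cancel between the two.\<close>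

lemma has_laplacian_u_refl:
  assumes "0 < snd (refl_line k d x)" "snd (refl_line k d x) < 1"
  shows "has_laplacian (\<lambda>x. u (refl_line k d x)) x (- f (u (refl_line k d x)))"
proof -
  define y where "y = refl_line k d x"
  define m where "m = 1 + k\<^sup>2"
  have m: "m \<noteq> 0" "m > 0" unfolding m_def by (rule one_plus_square_neq_0 one_plus_square_pos)+
  \<comment> \<open>Cosine and sine of twice the angle whose tangent is k.\<close>
  define p q where "p = (1 - k\<^sup>2) / m" and "q = 2 * k / m"
  have 1: "refl_line k d (fst x + t, snd x) = (fst y + t * p, snd y + t * q)" for t
    using m unfolding y_def refl_line_def gap_def p_def q_def
    by (simp add: divide_simps m_def[symmetric]) (simp add: m_def algebra_simps power2_eq_square)
  have 2: "refl_line k d (fst x, snd x + t) = (fst y + t * q, snd y + t * (- p))" for t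
    using m unfolding y_def refl_line_def gap_def p_def q_def
    by (simp add: divide_simps m_def[symmetric]) (simp add: m_def algebra_simps power2_eq_square)
  have "(1 - k\<^sup>2)\<^sup>2 + (2 * k)\<^sup>2 = m\<^sup>2" by (simp add: m_def power2_eq_square algebra_simps)
  then have pq: "p\<^sup>2 + q\<^sup>2 = 1" using m
    by (simp add: p_def q_def power_divide flip: add_divide_distrib)
  have y: "0 < snd y" "snd y < 1" using assms by (auto simp: y_def)
  have "has_laplacian (\<lambda>x. u (refl_line k d x)) x
     ((g11 y * p\<^sup>2 + (g12 y + g21 y) * (p * q) + g22 y * q\<^sup>2) +
      (g11 y * q\<^sup>2 + (g12 y + g21 y) * (q * (- p)) + g22 y * (- p)\<^sup>2))"
    unfolding has_laplacian_def 1 2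
    using twice_deriv_along_line[OF y, of "fst y" p q] twice_deriv_along_line[OF y, of "fst y" q "- p"]
    unfolding prod.collapse by blast
  also have "(g11 y * p\<^sup>2 + (g12 y + g21 y) * (p * q) + g22 y * q\<^sup>2) +
      (g11 y * q\<^sup>2 + (g12 y + g21 y) * (q * (- p)) + g22 y * (- p)\<^sup>2) = (g11 y + g22 y) * (p\<^sup>2 + q\<^sup>2)"
    by (simp add: algebra_simps power2_eq_square)
  also have "\<dots> = - f (u y)" using pde[OF y] pq by simp
  finally show ?thesis by (simp add: y_def)
qed

section \<open>The difference between the reflected and the original solution\<close>

definition refl_diff :: "real \<Rightarrow> real \<Rightarrow> real \<times> real \<Rightarrow> real"
  where "refl_diff k d x = u (refl_line k d x) - u x"

text \<open>The Laplacian is a difference of two values of f. The absolute value keeps the bound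
  usable before the sign of the difference is known; where it is nonnegative, this is the hypothesis
  of the Hopf lemma.\<close>

lemma has_laplacian_refl_diff:
  assumes "x \<in> cap_interior k d"
  obtains l where "has_laplacian (refl_diff k d) x l" "l \<le> L * \<bar>refl_diff k d x\<bar>"
proof
  note s = cap_interior_snd[OF assms]
  have "has_laplacian (\<lambda>x. u (refl_line k d x) + (- 1) * u x) x (- f (u (refl_line k d x)) + (- 1) * (- f (u x)))"
    using s by (intro has_laplacian_add has_laplacian_cmult has_laplacian_u has_laplacian_u_refl)
  then show "has_laplacian (refl_diff k d) x (f (u x) - f (u (refl_line k d x)))"
    by (simp add: refl_diff_def[abs_def])
  have "\<bar>f (u x) - f (u (refl_line k d x))\<bar> \<le> L * \<bar>u x - u (refl_line k d x)\<bar>"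
    using s by (intro lipschitz) (auto dest: range simp: less_imp_le)
  then show "f (u x) - f (u (refl_line k d x)) \<le> L * \<bar>refl_diff k d x\<bar>"
    by (simp add: refl_diff_def abs_minus_commute)
qed

lemma differentiable_refl_diff:
  assumes "x \<in> cap_interior k d"
  shows "refl_diff k d differentiable (at x)"
proof -
  note s = cap_interior_snd[OF assms]
  have "refl_line k d differentiable (at x)"
    unfolding refl_line_def[abs_def] gap_def
    by (intro derivative_intros differentiable_Pair bounded_linear_imp_differentiable
        bounded_linear_fst bounded_linear_snd) (auto simp: one_plus_square_neq_0)
  moreover have "u differentiable (at (refl_line k d x))" "u differentiable (at x)"
    using s deriv_u unfolding differentiable_def by blast+
  ultimately show ?thesis
    unfolding refl_diff_def[abs_def] using differentiable_chain_at[of "refl_line k d" x u]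
    by (intro differentiable_diff) (auto simp: o_def)
qed

lemma continuous_on_refl_diff: "continuous_on (cap k d) (refl_diff k d)"
proof -
  have "continuous_on (cap k d) (\<lambda>x. u (refl_line k d x))"
    using cap_snd by (intro continuous_on_compose2[OF cont(1)] continuous_intros image_subsetI) (simp add: mem_Times_iff)
  moreover have "continuous_on (cap k d) u"
    using cap_snd by (intro continuous_on_subset[OF cont(1)] subsetI) (simp add: mem_Times_iff)
  ultimately show ?thesis unfolding refl_diff_def[abs_def] by (intro continuous_intros)
qed

text \<open>Either x is on the bottom, where u = 0, and its image is strictly higher, or the image
  is on the top, where u = c, and x is strictly lower.\<close>

lemma refl_diff_pos_boundary:
  assumes "x \<in> cap k d" "gap k d x > 0" "x \<notin> cap_interior k d"
  shows "refl_diff k d x > 0"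
proof -
  have r: "snd (refl_line k d x) > snd x"
    using assms one_plus_square_pos[of k] by (simp add: refl_line_def)
  note s = cap_snd[OF assms(1)]
  consider "snd x = 0" | "snd (refl_line k d x) = 1" using assms s by (force simp: cap_interior_def)
  then show ?thesis
  proof cases
    case 1
    then have "u x = 0" using bottom[of "fst x"] by (cases x) auto
    then show ?thesis using u_pos[of "refl_line k d x"] r s 1 by (simp add: refl_diff_def)
  next
    case 2
    then have "u (refl_line k d x) = c" using top[of "fst (refl_line k d x)"]
      by (cases "refl_line k d x") auto
    then show ?thesis using u_less[of x] r s 2 by (simp add: refl_diff_def)
  qed
qed

lemma refl_diff_gap_0: "gap k d x = 0 \<Longrightarrow> refl_diff k d x = 0"
  by (simp add: refl_diff_def refl_line_gap_0)

text \<open>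
  The positive barrier \<open>1 - L gap\<^sup>2\<close> has Laplacian at most \<open>-2L\<close>, which beats the zero-order term.
\<close>

lemma narrow_cap_nonneg:
  assumes k: "k > 0" and \<epsilon>: "\<epsilon> > 0" "L * \<epsilon>\<^sup>2 \<le> 1 / 2"
    and side: "\<And>x. x \<in> cap k d \<Longrightarrow> fst x = b \<Longrightarrow> gap k d x > 0 \<Longrightarrow> refl_diff k d x > 0"
    and wide: "\<And>x. x \<in> cap k d \<Longrightarrow> fst x \<le> b \<Longrightarrow> gap k d x \<ge> \<epsilon> \<Longrightarrow> refl_diff k d x \<ge> 0"
    and x: "x \<in> cap k d" "fst x \<le> b"
  shows "refl_diff k d x \<ge> 0"
proof (rule ccontr)
  assume neg: "\<not> refl_diff k d x \<ge> 0"
  define A where "A = cap k d \<inter> {x. fst x \<le> b} \<inter> {x. gap k d x \<le> \<epsilon>}"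
  have "closed {x. gap k d x \<le> \<epsilon>}" by (intro closed_Collect_le continuous_intros)
  then have A: "compact A" unfolding A_def by (intro compact_Int_closed compact_cap k)
  have xA: "x \<in> A" using x neg wide[of x] by (force simp: A_def)
  define g where "g = (\<lambda>x. 1 + (- L) * (gap k d x)\<^sup>2)"
  have g: "g y \<ge> 1/2" if "y \<in> A" for y
  proof -
    have "(gap k d y)\<^sup>2 \<le> \<epsilon>\<^sup>2" using that by (intro power_mono) (auto simp: A_def cap_def)
    then have "L * (gap k d y)\<^sup>2 \<le> L * \<epsilon>\<^sup>2" using L_pos by (intro mult_left_mono) auto
    then show ?thesis using \<epsilon>(2) unfolding g_def by linarith
  qed
  have wg: "continuous_on A (\<lambda>y. refl_diff k d y / g y)"
  proof (intro continuous_intros)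
    show "continuous_on A (refl_diff k d)" by (rule continuous_on_subset[OF continuous_on_refl_diff]) (auto simp: A_def)
    show "continuous_on A g" unfolding g_def by (intro continuous_intros)
    show "\<forall>y\<in>A. g y \<noteq> 0" using g by force
  qed
  have "A \<noteq> {}" using xA by auto
  then obtain z where z: "z \<in> A" "\<And>y. y \<in> A \<Longrightarrow> refl_diff k d z / g z \<le> refl_diff k d y / g y"
    using continuous_attains_inf[OF A _ wg] by auto
  \<comment> \<open>Minimising the quotient by the barrier makes the difference plus
    \<open>m * g\<close> nonnegative with value 0 at z, where the second derivative test
    applies.\<close>
  define m where "m = - (refl_diff k d z / g z)"
  have "refl_diff k d x / g x < 0" using neg g[OF xA] by (simp add: divide_less_0_iff)
  then have m: "m > 0" using z(2)[OF xA] unfolding m_def by linarith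
  have wz: "refl_diff k d z = - (m * g z)" using g[OF z(1)] by (simp add: m_def)
  then have wz_neg: "refl_diff k d z < 0" using m g[OF z(1)] by (simp add: mult_pos_pos)
  have zc: "z \<in> cap k d" "fst z \<le> b" using z(1) by (auto simp: A_def)
  have z_gap: "0 < gap k d z" "gap k d z < \<epsilon>"
    using wz_neg wide[OF zc] refl_diff_gap_0[of k d z] zc(1) by (force simp: cap_def)+
  have z_int: "z \<in> cap_interior k d" using refl_diff_pos_boundary[OF zc(1) z_gap(1)] wz_neg by force
  have z_b: "fst z < b" using side[OF zc(1) _ z_gap(1)] wz_neg zc(2) by force
  define V where "V = cap_interior k d \<inter> {x. fst x < b} \<inter> {x. gap k d x < \<epsilon>}"
  have "open V" unfolding V_def
    by (intro open_Int open_cap_interior open_Collect_less continuous_intros)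
  moreover have "z \<in> V" using z_int z_b z_gap by (simp add: V_def)
  ultimately have "\<forall>\<^sub>F y in nhds z. y \<in> V" by (rule eventually_nhds_in_open)
  then have ev: "\<forall>\<^sub>F y in nhds z. refl_diff k d z + m * g z \<le> refl_diff k d y + m * g y"
  proof eventually_elim
    case (elim y)
    then have yA: "y \<in> A" using cap_interior_subset by (auto simp: V_def A_def)
    have "- m \<le> refl_diff k d y / g y" using z(2)[OF yA] by (simp add: m_def)
    then have "- m * g y \<le> refl_diff k d y" using g[OF yA] by (simp add: pos_le_divide_eq)
    then show ?case using wz by simp
  qed
  obtain l where l: "has_laplacian (refl_diff k d) z l" "l \<le> L * \<bar>refl_diff k d z\<bar>" using has_laplacian_refl_diff[OF z_int] .
  have "has_laplacian g z (0 + (- L) * (2 * (1 + k\<^sup>2)))"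
    unfolding g_def gap_def by (intro has_laplacian_add has_laplacian_cmult has_laplacian_const has_laplacian_affine_square)
  then have "has_laplacian (\<lambda>x. refl_diff k d x + m * g x) z (l + m * (0 + (- L) * (2 * (1 + k\<^sup>2))))"
    by (intro has_laplacian_add has_laplacian_cmult l)
  then have "0 \<le> l + m * (0 + (- L) * (2 * (1 + k\<^sup>2)))" using ev by (rule has_laplacian_local_min)
  \<comment> \<open>The barrier contributes at least 2 m L, the zero-order term at most m L because
    \<open>g z \<le> 1\<close>.\<close>
  then have "m * L * (2 * (1 + k\<^sup>2)) \<le> L * \<bar>refl_diff k d z\<bar>" using l(2) by (simp add: algebra_simps)
  also have "\<dots> = m * L * g z" using wz wz_neg by simp
  also have "\<dots> \<le> m * L * 1" using m L_pos by (intro mult_left_mono) (auto simp: g_def)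
  finally have "2 * (1 + k\<^sup>2) \<le> 1" using m L_pos by (simp add: mult_le_cancel_left_pos)
  moreover have "2 * 1 \<le> 2 * (1 + k\<^sup>2)" by (intro mult_left_mono) auto
  ultimately show False by linarith
qed

end

section \<open>Sweeping with a family of lines\<close>

lemma cap_limit:
  assumes "(k \<longlongrightarrow> k0) F" "(d \<longlongrightarrow> d0) F" "(x \<longlongrightarrow> x0) F" "F \<noteq> bot"
    and "\<forall>\<^sub>F t in F. x t \<in> cap (k t) (d t)"
  shows "x0 \<in> cap k0 d0"
proof -
  have "\<forall>\<^sub>F t in F. 0 \<le> snd (x t)" "\<forall>\<^sub>F t in F. 0 \<le> gap (k t) (d t) (x t)"
      "\<forall>\<^sub>F t in F. snd (refl_line (k t) (d t) (x t)) \<le> 1"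
    using assms(5) by (auto elim!: eventually_mono simp: cap_def)
  then show ?thesis
    unfolding cap_def mem_Collect_eq using assms(1-4)
    by (intro conjI tendsto_lowerbound[of "\<lambda>t. snd (x t)" _ F]
        tendsto_lowerbound[of "\<lambda>t. gap (k t) (d t) (x t)" _ F]
        tendsto_upperbound[of "\<lambda>t. snd (refl_line (k t) (d t) (x t))" _ F] tendsto_intros)
qed

context strip_solution
begin

lemma tendsto_refl_diff:
  assumes "(k \<longlongrightarrow> k0) F" "(d \<longlongrightarrow> d0) F" "(x \<longlongrightarrow> x0) F"
    and ev: "\<forall>\<^sub>F t in F. x t \<in> cap (k t) (d t)" and "x0 \<in> cap k0 d0"
  shows "((\<lambda>t. refl_diff (k t) (d t) (x t)) \<longlongrightarrow> refl_diff k0 d0 x0) F"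
proof -
  have "((\<lambda>t. u (refl_line (k t) (d t) (x t))) \<longlongrightarrow> u (refl_line k0 d0 x0)) F"
    using assms(1-3) cap_snd[OF assms(5)] ev
    by (intro continuous_on_tendsto_compose[OF cont(1)] tendsto_intros)
      (auto simp: mem_Times_iff dest: cap_snd elim!: eventually_mono)
  moreover have "((\<lambda>t. u (x t)) \<longlongrightarrow> u x0) F"
    using assms(1-3) cap_snd[OF assms(5)] ev
    by (intro continuous_on_tendsto_compose[OF cont(1)])
      (auto simp: mem_Times_iff dest: cap_snd elim!: eventually_mono)
  ultimately show ?thesis unfolding refl_diff_def by (intro tendsto_intros)
qed

text \<open>By the strong maximum principle a zero would spread over the whole connected region. A
  vertical segment downwards, along which x1 is fixed and the gap grows, ends at a boundary point
  off the line, where the difference is strictly positive; this contradicts continuity.\<close>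

lemma cap_interior_pos:
  assumes nonneg: "\<And>x. x \<in> cap_interior k d \<Longrightarrow> fst x < b \<Longrightarrow> refl_diff k d x \<ge> 0"
    and z: "z \<in> cap_interior k d" "fst z < b"
  shows "refl_diff k d z > 0"
proof (rule ccontr)
  assume "\<not> refl_diff k d z > 0"
  then have wz: "refl_diff k d z = 0" using nonneg[OF z] by simp
  define U where "U = cap_interior k d \<inter> {x. fst x < b}"
  have "open U" unfolding U_def by (intro open_Int open_cap_interior open_Collect_less continuous_intros)
  have "convex {x :: real \<times> real. fst x < b}"
    by (rule convexI) (auto intro: convex_bound_lt)
  then have "connected U" unfolding U_def by (intro convex_connected convex_Int convex_cap_interior)
  have zero: "refl_diff k d x = 0" if "x \<in> U" for x
  proof (rule strong_maximum_principle[OF \<open>open U\<close> \<open>connected U\<close>, of L "refl_diff k d" z])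
    show "\<exists>l. has_laplacian (refl_diff k d) y l \<and> l \<le> L * refl_diff k d y" if "y \<in> U" for y
      using has_laplacian_refl_diff[of y k d] nonneg[of y] that unfolding U_def by (metis IntE abs_of_nonneg mem_Collect_eq)
  qed (use L_pos differentiable_refl_diff nonneg z wz that in \<open>auto simp: U_def\<close>)
  define p where "p = (fst z, 0 :: real)"
  define \<rho> where "\<rho> = (\<lambda>x. snd (refl_line k d x))"
  have z': "snd z > 0" "gap k d z > 0" "\<rho> z < 1" using z by (auto simp: cap_interior_def \<rho>_def)
  have gp: "gap k d p > 0" using z' by (simp add: gap_def p_def)
  \<comment> \<open>Exit parameter of the segment from z down to its foot p: the bottom if the image
    of p is still in the strip, otherwise the parameter at which the image reaches height 1.\<close>
  define t0 where "t0 = (if \<rho> p \<le> 1 then 1 else (1 - \<rho> z) / (\<rho> p - \<rho> z))"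
  have t0: "0 < t0" "t0 \<le> 1" using z' by (auto simp: t0_def)
  define y where "y = (\<lambda>t. (1 - t) *\<^sub>R z + t *\<^sub>R p)"
  have \<rho>y: "\<rho> (y t) = \<rho> z + t * (\<rho> p - \<rho> z)" for t
    unfolding \<rho>_def y_def by (subst snd_refl_line_affine) (auto simp: algebra_simps)
  have gy: "gap k d (y t) > 0" if "0 \<le> t" "t \<le> 1" for t
    unfolding y_def using that gp z' by (subst gap_affine) (auto intro!: affine_gt)
  have inU: "y t \<in> U" if "0 \<le> t" "t < t0" for t
  proof -
    have t1: "t < 1" using that t0 by simp
    have "\<rho> (y t) < 1"
    proof (cases "\<rho> p \<le> 1")
      case True
      have "(1 - t) * \<rho> z < (1 - t) * 1" using t1 z' by (intro mult_strict_left_mono) auto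
      moreover have "t * \<rho> p \<le> t * 1" using that True by (intro mult_left_mono) auto
      ultimately show ?thesis unfolding \<rho>y by (simp add: algebra_simps)
    next
      case False
      then have "t * (\<rho> p - \<rho> z) < 1 - \<rho> z" using that z' by (simp add: t0_def pos_less_divide_eq)
      then show ?thesis unfolding \<rho>y by simp
    qed
    then show ?thesis using gy[of t] that t1 z' z(2)
      by (auto simp: U_def cap_interior_def \<rho>_def) (auto simp: y_def p_def algebra_simps)
  qed
  have \<rho>1: "\<rho> (y t0) \<le> 1" "t0 = 1 \<or> \<rho> (y t0) = 1"
    unfolding \<rho>y using z' by (auto simp: t0_def)
  have y0: "y t0 \<in> cap k d" using gy[of t0] t0 z' \<rho>1 by (auto simp: cap_def \<rho>_def y_def p_def)
  have "y t0 \<notin> cap_interior k d" using \<rho>1 by (auto simp: cap_interior_def \<rho>_def y_def p_def)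
  then have pos: "refl_diff k d (y t0) > 0" using refl_diff_pos_boundary[OF y0] gy[of t0] t0 by simp
  have cl: "closure {0..<t0} = {0..t0}" using t0 by simp
  have "refl_diff k d (y t0) = 0"
  proof (rule continuous_constant_on_closure[of "{0..<t0}" "\<lambda>t. refl_diff k d (y t)"])
    have "y t \<in> cap k d" if "t \<in> {0..t0}" for t
      using inU[of t] y0 that cap_interior_subset by (cases "t = t0") (auto simp: U_def)
    then show "continuous_on (closure {0..<t0}) (\<lambda>t. refl_diff k d (y t))" unfolding cl
      by (intro continuous_on_compose2[OF continuous_on_refl_diff]) (auto simp: y_def intro!: continuous_intros)
    show "refl_diff k d (y t) = 0" if "t \<in> {0..<t0}" for t using that inU zero by simp
    show "t0 \<in> closure {0..<t0}" using cl t0 by simp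
  qed
  with pos show False by simp
qed

text \<open>
  At the infimum of the bad parameters the difference is positive in the open cap. A limit of
  negative points stays at distance \<open>\<epsilon>\<close> from the line, by the slab estimate, hence would be a zero there.
\<close>

lemma sweep:
  fixes k0 k1 d0 d1 b :: real
  defines "K \<equiv> \<lambda>t. k0 + t * (k1 - k0)" and "D \<equiv> \<lambda>t. d0 + t * (d1 - d0)"
  assumes k: "k0 > 0" "k1 > 0"
    and start: "\<And>x. x \<in> cap k0 d0 \<Longrightarrow> fst x \<le> b \<Longrightarrow> refl_diff k0 d0 x \<ge> 0"
    and side: "\<And>t x. 0 \<le> t \<Longrightarrow> t \<le> 1 \<Longrightarrow> x \<in> cap (K t) (D t) \<Longrightarrow> fst x = b \<Longrightarrow>
      gap (K t) (D t) x > 0 \<Longrightarrow> refl_diff (K t) (D t) x > 0"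
    and x: "x \<in> cap k1 d1" "fst x \<le> b"
  shows "refl_diff k1 d1 x \<ge> 0"
proof (rule ccontr)
  assume neg: "\<not> refl_diff k1 d1 x \<ge> 0"
  \<comment> \<open>Slopes and intercepts on the path are convex combinations, so the slope stays at
    least kmin and all truncated triangles lie in one box.\<close>
  define kmin where "kmin = min k0 k1"
  have kmin: "kmin > 0" using k by (simp add: kmin_def)
  have K: "K t \<ge> kmin" "D t \<le> \<bar>d0\<bar> + \<bar>d1\<bar>" if "0 \<le> t" "t \<le> 1" for t
  proof -
    have "(1 - t) * kmin \<le> (1 - t) * k0" "t * kmin \<le> t * k1"
      using that by (auto intro!: mult_left_mono simp: kmin_def)
    then show "K t \<ge> kmin" by (simp add: K_def algebra_simps)
    have "(1 - t) * d0 \<le> (1 - t) * \<bar>d0\<bar>" "t * d1 \<le> t * \<bar>d1\<bar>"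
      using that by (auto intro!: mult_left_mono)
    moreover have "(1 - t) * \<bar>d0\<bar> \<le> \<bar>d0\<bar>" "t * \<bar>d1\<bar> \<le> \<bar>d1\<bar>"
      using that by (auto intro!: mult_left_le_one_le)
    ultimately show "D t \<le> \<bar>d0\<bar> + \<bar>d1\<bar>" by (simp add: D_def algebra_simps)
  qed
  define \<epsilon> where "\<epsilon> = sqrt (1 / (2 * L))"
  have \<epsilon>: "\<epsilon> > 0" "L * \<epsilon>\<^sup>2 \<le> 1 / 2" using L_pos by (auto simp: \<epsilon>_def)
  \<comment> \<open>The lower bound on the gap survives limits and keeps the limit point off the
    line. Conversely, if no negative point has such a gap, the slab estimate excludes negative
    points altogether.\<close>
  define Bad where "Bad = {t. 0 \<le> t \<and> t \<le> 1 \<and>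
    (\<exists>x\<in>cap (K t) (D t). fst x \<le> b \<and> \<epsilon> \<le> gap (K t) (D t) x \<and> refl_diff (K t) (D t) x < 0)}"
  have good: "refl_diff (K t) (D t) y \<ge> 0" if "0 \<le> t" "t \<le> 1" "t \<notin> Bad" "y \<in> cap (K t) (D t)" "fst y \<le> b" for t y
  proof (rule narrow_cap_nonneg[of "K t" \<epsilon> "D t" b])
    show "K t > 0" using K[of t] kmin that by linarith
  qed (use that \<epsilon> side in \<open>force simp: Bad_def\<close>)+
  have "1 \<in> Bad" using good[of 1 x] x neg by (auto simp: K_def D_def)
  have bdd: "bdd_below Bad" by (rule bdd_belowI[of _ 0]) (simp add: Bad_def)
  define T where "T = Inf Bad"
  have T: "0 \<le> T" "T \<le> 1" using \<open>1 \<in> Bad\<close> bdd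
    by (auto simp: T_def Bad_def intro!: cInf_greatest cInf_lower)
  have "T \<in> closure Bad" unfolding T_def using \<open>1 \<in> Bad\<close> bdd by (intro closure_contains_Inf) auto
  then obtain ts where ts: "\<And>n. ts n \<in> Bad" "ts \<longlonglongrightarrow> T" unfolding closure_sequential by blast
  then have "\<forall>n. \<exists>x. x \<in> cap (K (ts n)) (D (ts n)) \<and> fst x \<le> b \<and> \<epsilon> \<le> gap (K (ts n)) (D (ts n)) x \<and>
      refl_diff (K (ts n)) (D (ts n)) x < 0" unfolding Bad_def by blast
  then obtain xs where xs: "\<And>n. xs n \<in> cap (K (ts n)) (D (ts n))" "\<And>n. fst (xs n) \<le> b"
    "\<And>n. \<epsilon> \<le> gap (K (ts n)) (D (ts n)) (xs n)" "\<And>n. refl_diff (K (ts n)) (D (ts n)) (xs n) < 0"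
    by metis
  define M where "M = (\<bar>d0\<bar> + \<bar>d1\<bar>) / kmin"
  have box: "xs n \<in> cbox (- M, 0) (\<bar>b\<bar>, 1)" for n
  proof -
    have t: "0 \<le> ts n" "ts n \<le> 1" using ts(1)[of n] by (auto simp: Bad_def)
    have "fst (xs n) \<ge> - M"
    proof (cases "fst (xs n) \<ge> 0")
      case True
      have "M \<ge> 0" using kmin by (simp add: M_def)
      with True show ?thesis by linarith
    next
      case False
      have "0 \<le> D (ts n) + K (ts n) * fst (xs n)" using xs(1)[of n] by (auto simp: cap_def gap_def)
      also have "\<dots> \<le> (\<bar>d0\<bar> + \<bar>d1\<bar>) + kmin * fst (xs n)"
        using K[OF t] False by (intro add_mono mult_right_mono_neg) auto
      finally show ?thesis using kmin by (simp add: M_def field_simps)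
    qed
    then show ?thesis using cap_snd[OF xs(1)[of n]] xs(2)[of n] by (cases "xs n") (auto simp: cbox_Pair_iff)
  qed
  have "compact (cbox (- M, 0) (\<bar>b\<bar>, 1 :: real))" by simp
  then obtain X r where r: "strict_mono r" "(xs \<circ> r) \<longlonglongrightarrow> X"
    using box unfolding compact_def by metis
  have lim_t: "(\<lambda>n. ts (r n)) \<longlonglongrightarrow> T" using LIMSEQ_subseq_LIMSEQ[OF ts(2) r(1)] by (simp add: o_def)
  have lim_x: "(\<lambda>n. xs (r n)) \<longlonglongrightarrow> X" using r(2) by (simp add: o_def)
  have lim_K: "((\<lambda>t. K (s t)) \<longlongrightarrow> K T) F" "((\<lambda>t. D (s t)) \<longlongrightarrow> D T) F"
    if "(s \<longlongrightarrow> T) F" for s :: "'z \<Rightarrow> real" and F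
    unfolding K_def D_def by (intro tendsto_intros that)+
  have X: "X \<in> cap (K T) (D T)"
    by (rule cap_limit[OF lim_K[OF lim_t] lim_x]) (auto simp: xs)
  have wX: "refl_diff (K T) (D T) X \<le> 0"
    by (rule tendsto_upperbound[OF tendsto_refl_diff[OF lim_K[OF lim_t] lim_x _ X]]) (auto simp: xs less_imp_le)
  have "gap (K T) (D T) X \<ge> \<epsilon>"
    by (rule tendsto_lowerbound[OF tendsto_gap[OF lim_K[OF lim_t] lim_x]]) (auto simp: xs)
  then have gX: "gap (K T) (D T) X > 0" using \<epsilon> by simp
  have "fst X \<le> b" by (rule tendsto_upperbound[OF tendsto_fst[OF lim_x]]) (auto simp: xs)
  then have bX: "fst X < b" using side[OF T X _ gX] wX by force
  have iX: "X \<in> cap_interior (K T) (D T)" using refl_diff_pos_boundary[OF X gX] wX by force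
  \<comment> \<open>Every interior point at parameter T belongs to the triangles for t slightly
    below T, which are good because T is the infimum; for T = 0 the starting assumption is
    used.\<close>
  have "refl_diff (K T) (D T) y \<ge> 0" if y: "y \<in> cap_interior (K T) (D T)" "fst y < b" for y
  proof (cases "T = 0")
    case True
    then show ?thesis using start[of y] y cap_interior_subset by (auto simp: K_def D_def)
  next
    case False
    define F where "F = at_left T"
    have lim: "((\<lambda>t. t) \<longlongrightarrow> T) F" by (simp add: F_def tendsto_ident_at)
    have "\<forall>\<^sub>F t in F. t \<in> {0<..<T}"
      unfolding F_def using False T by (intro eventually_at_left_real) auto
    moreover have "\<forall>\<^sub>F t in F. 0 < gap (K t) (D t) y" "\<forall>\<^sub>F t in F. snd (refl_line (K t) (D t) y) < 1"
      using y by (auto intro!: order_tendstoD[OF tendsto_gap[OF lim_K[OF lim] tendsto_const]]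
        order_tendstoD[OF tendsto_snd[OF tendsto_refl_line[OF lim_K[OF lim] tendsto_const]]] simp: cap_interior_def)
    ultimately have ev: "\<forall>\<^sub>F t in F. y \<in> cap (K t) (D t) \<and> refl_diff (K t) (D t) y \<ge> 0"
    proof eventually_elim
      case (elim t)
      then have cap: "y \<in> cap (K t) (D t)" using y by (auto simp: cap_def cap_interior_def)
      moreover have "t \<notin> Bad" using elim(1) cInf_lower[OF _ bdd, of t] by (auto simp: T_def)
      ultimately show ?case using good[of t y] elim(1) T y by auto
    qed
    have yc: "y \<in> cap (K T) (D T)" using y cap_interior_subset by blast
    have "((\<lambda>t. refl_diff (K t) (D t) y) \<longlongrightarrow> refl_diff (K T) (D T) y) F"
      using ev by (intro tendsto_refl_diff[OF lim_K[OF lim] tendsto_const _ yc]) (auto elim: eventually_mono)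
    then show ?thesis
      by (rule tendsto_lowerbound) (use ev in \<open>auto elim: eventually_mono simp: F_def\<close>)
  qed
  from cap_interior_pos[OF this iX bX] wX show False by simp
qed

end

section \<open>Behaviour at the boundary\<close>

lemma continuous_on_strip_box:
  fixes F :: "real \<times> real \<Rightarrow> real"
  assumes "continuous_on (UNIV \<times> {0..1}) F" "0 \<le> h" "h \<le> 1" "e > 0"
  obtains r where "r > 0"
    "\<And>a b. 0 \<le> b \<Longrightarrow> b \<le> 1 \<Longrightarrow> \<bar>a - p\<bar> < r \<Longrightarrow> \<bar>b - h\<bar> < r \<Longrightarrow> \<bar>F (a, b) - F (p, h)\<bar> < e"
proof -
  have "(p, h) \<in> UNIV \<times> {0..1}" using assms by simp
  then obtain \<delta> where \<delta>: "\<delta> > 0"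
    "\<And>x. x \<in> UNIV \<times> {0..1} \<Longrightarrow> dist x (p, h) < \<delta> \<Longrightarrow> dist (F x) (F (p, h)) < e"
    using assms(1,4) unfolding continuous_on_iff by blast
  show thesis
  proof (rule that[of "\<delta> / 2"])
    fix a b :: real
    assume *: "0 \<le> b" "b \<le> 1" "\<bar>a - p\<bar> < \<delta> / 2" "\<bar>b - h\<bar> < \<delta> / 2"
    have "dist (a, b) (p, h) \<le> \<bar>a - p\<bar> + \<bar>b - h\<bar>"
      unfolding dist_Pair_Pair dist_real_def by (intro sqrt_sum_squares_le_sum_abs[THEN order_trans]) auto
    then have "dist (a, b) (p, h) < \<delta>" using * by linarith
    then show "\<bar>F (a, b) - F (p, h)\<bar> < e" using \<delta>(2)[of "(a, b)"] * by (simp add: dist_real_def)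
  qed (use \<delta> in simp)
qed

text \<open>The ends of the segment may lie on the boundary lines, where only continuity is
  available.\<close>

lemma segment_mvt:
  fixes F :: "real \<times> real \<Rightarrow> real"
  assumes cont: "continuous_on (UNIV \<times> {0..1}) F"
    and deriv: "\<And>x. 0 < snd x \<Longrightarrow> snd x < 1 \<Longrightarrow> (F has_derivative (\<lambda>h. A x * fst h + B x * snd h)) (at x)"
    and T: "T > 0"
    and cl: "\<And>t. 0 \<le> t \<Longrightarrow> t \<le> T \<Longrightarrow> 0 \<le> b + t * q \<and> b + t * q \<le> 1"
    and op: "\<And>t. 0 < t \<Longrightarrow> t < T \<Longrightarrow> 0 < b + t * q \<and> b + t * q < 1"
  shows "\<exists>\<xi>>0. \<xi> < T \<and>
    F (a + T * p, b + T * q) - F (a, b) = T * (A (a + \<xi> * p, b + \<xi> * q) * p + B (a + \<xi> * p, b + \<xi> * q) * q)"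
proof -
  have 1: "continuous_on {0..T} (\<lambda>t. F (a + t * p, b + t * q))"
    by (intro continuous_on_compose2[OF cont] continuous_intros) (use cl in auto)
  have 2: "((\<lambda>t. F (a + t * p, b + t * q)) has_real_derivative
      A (a + t * p, b + t * q) * p + B (a + t * p, b + t * q) * q) (at t)" if "0 < t" "t < T" for t
    using op[OF that] by (intro has_derivative_along_line deriv) auto
  have "\<exists>\<xi>>0. \<xi> < T \<and> F (a + T * p, b + T * q) - F (a + 0 * p, b + 0 * q) =
      (T - 0) * (A (a + \<xi> * p, b + \<xi> * q) * p + B (a + \<xi> * p, b + \<xi> * q) * q)"
  proof -
    define G where "G = (\<lambda>t. F (a + t * p, b + t * q))"
    have "\<exists>l z. 0 < z \<and> z < T \<and> DERIV G z :> l \<and> G T - G 0 = (T - 0) * l"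
      using 1 2 by (intro MVT[OF T]) (auto simp: G_def real_differentiable_def)
    then obtain l z where z: "0 < z" "z < T" "DERIV G z :> l" "G T - G 0 = (T - 0) * l" by blast
    have "l = A (a + z * p, b + z * q) * p + B (a + z * p, b + z * q) * q"
      using DERIV_unique[OF z(3)] 2[OF z(1,2)] unfolding G_def by blast
    then show ?thesis using z unfolding G_def by blast
  qed
  then show ?thesis by simp
qed

text \<open>On the bottom A is only a continuous extension, not a derivative taken there. Hence the
  mean value theorem is applied on a horizontal segment slightly above the bottom, at whose ends F
  is small compared with its length.\<close>

lemma tangential_derivative_zero:
  fixes F :: "real \<times> real \<Rightarrow> real"
  assumes cont: "continuous_on (UNIV \<times> {0..1}) F" "continuous_on (UNIV \<times> {0..1}) A"
    and deriv: "\<And>x. 0 < snd x \<Longrightarrow> snd x < 1 \<Longrightarrow> (F has_derivative (\<lambda>h. A x * fst h + B x * snd h)) (at x)"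
    and zero: "\<And>a. F (a, 0) = 0"
  shows "A (a, 0) = 0"
proof (rule ccontr)
  assume "A (a, 0) \<noteq> 0"
  define e where "e = \<bar>A (a, 0)\<bar> / 3"
  have e: "e > 0" using \<open>A (a, 0) \<noteq> 0\<close> by (simp add: e_def)
  obtain r where r: "r > 0"
    "\<And>a' b. 0 \<le> b \<Longrightarrow> b \<le> 1 \<Longrightarrow> \<bar>a' - a\<bar> < r \<Longrightarrow> \<bar>b - 0\<bar> < r \<Longrightarrow> \<bar>A (a', b) - A (a, 0)\<bar> < e"
    using continuous_on_strip_box[OF cont(2), of 0 e a] e by auto
  define T where "T = r / 2"
  have T: "T > 0" using r by (simp add: T_def)
  obtain r1 where r1: "r1 > 0"
    "\<And>a' b. 0 \<le> b \<Longrightarrow> b \<le> 1 \<Longrightarrow> \<bar>a' - a\<bar> < r1 \<Longrightarrow> \<bar>b - 0\<bar> < r1 \<Longrightarrow> \<bar>F (a', b) - F (a, 0)\<bar> < e * T / 2"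
    using continuous_on_strip_box[OF cont(1), of 0 "e * T / 2" a] e T by auto
  obtain r2 where r2: "r2 > 0"
    "\<And>a' b. 0 \<le> b \<Longrightarrow> b \<le> 1 \<Longrightarrow> \<bar>a' - (a + T)\<bar> < r2 \<Longrightarrow> \<bar>b - 0\<bar> < r2 \<Longrightarrow> \<bar>F (a', b) - F (a + T, 0)\<bar> < e * T / 2"
    using continuous_on_strip_box[OF cont(1), of 0 "e * T / 2" "a + T"] e T by auto
  define y where "y = min (1/2) (min (r/2) (min (r1/2) (r2/2)))"
  have y: "0 < y" "y < 1" "y < r" "y < r1" "y < r2" using r r1 r2 by (auto simp: y_def)
  have "\<exists>\<xi>>0. \<xi> < T \<and> F (a + T * 1, y + T * 0) - F (a, y) =
      T * (A (a + \<xi> * 1, y + \<xi> * 0) * 1 + B (a + \<xi> * 1, y + \<xi> * 0) * 0)"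
    by (rule segment_mvt[where F = F and A = A and B = B and T = T and b = y and q = 0 and a = a and p = 1])
      (use y cont deriv T in auto)
  then obtain \<xi> where \<xi>: "0 < \<xi>" "\<xi> < T" "F (a + T, y) - F (a, y) = T * A (a + \<xi>, y)" by auto
  have "\<bar>F (a, y)\<bar> < e * T / 2" "\<bar>F (a + T, y)\<bar> < e * T / 2"
    using r1(2)[of y a] r2(2)[of y "a + T"] y r1(1) r2(1) by (auto simp: zero)
  moreover have "T * A (a + \<xi>, y) = F (a + T, y) - F (a, y)" using \<xi>(3) by (rule sym)
  ultimately have "\<bar>T * A (a + \<xi>, y)\<bar> < e * T" by linarith
  then have "\<bar>A (a + \<xi>, y)\<bar> < e" using T by (simp add: abs_mult mult.commute)
  moreover have "\<bar>A (a + \<xi>, y) - A (a, 0)\<bar> < e" using r(2)[of y "a + \<xi>"] \<xi> y by (simp add: T_def)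
  ultimately show False unfolding e_def by linarith
qed

context strip_solution
begin

text \<open>Reflection in a line of slope k moves points along (-k, 1); hence a cone of nearly
  vertical directions (m, 1), with m of either sign so that the notion survives turning the strip
  upside down. Only points of the open strip count, since \<open>g2\<close> may vanish on the
  boundary.\<close>

definition locally_increasing :: "real \<Rightarrow> bool"
  where "locally_increasing h \<longleftrightarrow> (\<exists>r>0. \<exists>\<delta>>0. \<forall>a b m. 0 < b \<longrightarrow> b < 1 \<longrightarrow> \<bar>a\<bar> < r \<longrightarrow> \<bar>b - h\<bar> < r \<longrightarrow>
    \<bar>m\<bar> \<le> \<delta> \<longrightarrow> m * g1 (a, b) + g2 (a, b) > 0)"

lemma vertical_mvt:
  assumes "0 \<le> y1" "y1 < y2" "y2 \<le> 1"
  obtains \<xi> where "y1 < \<xi>" "\<xi> < y2" "u (a, y2) - u (a, y1) = (y2 - y1) * g2 (a, \<xi>)"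
proof -
  have "\<exists>\<xi>>0. \<xi> < y2 - y1 \<and> u (a + (y2 - y1) * 0, y1 + (y2 - y1) * 1) - u (a, y1) =
      (y2 - y1) * (g1 (a + \<xi> * 0, y1 + \<xi> * 1) * 0 + g2 (a + \<xi> * 0, y1 + \<xi> * 1) * 1)"
    by (rule segment_mvt[where F = u and A = g1 and B = g2 and T = "y2 - y1" and b = y1 and q = 1 and a = a and p = 0])
      (fact cont(1), erule (1) deriv_u, use assms in auto)
  then obtain \<xi> where "0 < \<xi>" "\<xi> < y2 - y1" "u (a, y2) - u (a, y1) = (y2 - y1) * g2 (a, y1 + \<xi>)" by auto
  then have "y1 < y1 + \<xi>" "y1 + \<xi> < y2" "u (a, y2) - u (a, y1) = (y2 - y1) * g2 (a, y1 + \<xi>)"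
    by auto
  then show thesis by (rule that)
qed

lemma g2_bottom_ge:
  assumes "y0 > 0" "\<And>y. 0 < y \<Longrightarrow> y < y0 \<Longrightarrow> u (a, y) \<ge> \<kappa> * y"
  shows "g2 (a, 0) \<ge> \<kappa>"
proof (rule ccontr)
  assume "\<not> g2 (a, 0) \<ge> \<kappa>"
  then obtain r where r: "r > 0"
    "\<And>a' b. 0 \<le> b \<Longrightarrow> b \<le> 1 \<Longrightarrow> \<bar>a' - a\<bar> < r \<Longrightarrow> \<bar>b - 0\<bar> < r \<Longrightarrow> \<bar>g2 (a', b) - g2 (a, 0)\<bar> < \<kappa> - g2 (a, 0)"
    using continuous_on_strip_box[OF cont(3), of 0 "\<kappa> - g2 (a, 0)" a] by auto
  define y where "y = min (1/2) (min (r/2) (y0/2))"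
  have y: "0 < y" "y < 1" "y < r" "y < y0" using r assms(1) by (auto simp: y_def)
  obtain \<xi> where \<xi>: "0 < \<xi>" "\<xi> < y" "u (a, y) - u (a, 0) = (y - 0) * g2 (a, \<xi>)"
    using vertical_mvt[of 0 y a] y by auto
  have "g2 (a, \<xi>) < \<kappa>" using r(2)[of \<xi> a] \<xi> y by auto
  then have "y * g2 (a, \<xi>) < y * \<kappa>" using y by simp
  then show False using assms(2)[of y] \<xi>(3) y bottom by (simp add: mult.commute)
qed

lemma g2_bottom_nonneg: "g2 (a, 0) \<ge> 0"
  using range by (intro g2_bottom_ge[of 1]) (auto intro: less_imp_le)

text \<open>Hopf lemma in the disc of radius 1/4 touching the bottom at (a, 0). The sign of
  \<open>f 0\<close> gives the required bound:
  \<open>- f (u x) \<le> f 0 - f (u x) \<le> L * u x\<close>.\<close>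

lemma g2_bottom_pos:
  assumes "f 0 \<ge> 0"
  shows "g2 (a, 0) > 0"
proof -
  define q where "q = (a, 1/4 :: real)"
  have snd_q: "\<bar>snd x - 1/4\<bar> \<le> dist q x" for x
    using dist_snd_le[of q x] by (simp add: q_def dist_real_def abs_minus_commute)
  have ball: "0 < snd x" "snd x < 1" if "dist q x < 1/4" for x using snd_q[of x] that by (auto simp: abs_if split: if_splits)
  have cball: "0 \<le> snd x" "snd x \<le> 1" if "dist q x \<le> 1/4" for x using snd_q[of x] that by (auto simp: abs_if split: if_splits)
  have "\<exists>\<kappa>>0. \<forall>x. (1/4) / 2 \<le> dist q x \<longrightarrow> dist q x \<le> 1/4 \<longrightarrow> u x \<ge> \<kappa> * (1/4 - dist q x)"
  proof (rule hopf)
    show "continuous_on (cball q (1/4)) u"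
      using cball by (intro continuous_on_subset[OF cont(1)] subsetI) (auto simp: mem_Times_iff)
    show "u x \<ge> 0" if "x \<in> cball q (1/4)" for x using range_closed[of x] cball[of x] that by simp
    show "\<exists>l. has_laplacian u x l \<and> l \<le> L * u x" if "x \<in> ball q (1/4)" for x
    proof (intro exI conjI)
      have x: "0 < snd x" "snd x < 1" using ball[of x] that by auto
      show "has_laplacian u x (- f (u x))" by (rule has_laplacian_u[OF x])
      show "- f (u x) \<le> L * u x"
        using lipschitz[of "u x" 0] range[OF x] c_pos assms by auto
    qed
    show "0 < u x" if "x \<in> cball q (1/4/2)" for x using range[of x] ball[of x] that by simp
  qed (use L_pos in auto)
  then obtain \<kappa> where \<kappa>: "\<kappa> > 0"
    "\<And>x. 1/8 \<le> dist q x \<Longrightarrow> dist q x \<le> 1/4 \<Longrightarrow> u x \<ge> \<kappa> * (1/4 - dist q x)" by auto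
  have "g2 (a, 0) \<ge> \<kappa>"
  proof (rule g2_bottom_ge[of "1/8"])
    fix y :: real assume y: "0 < y" "y < 1/8"
    have "dist q (a, y) = 1/4 - y" using y by (simp add: q_def dist_Pair_Pair dist_real_def)
    then show "u (a, y) \<ge> \<kappa> * y" using \<kappa>(2)[of "(a, y)"] y by simp
  qed simp
  with \<kappa> show ?thesis by simp
qed

lemma locally_increasing_pos:
  assumes h: "0 \<le> h" "h \<le> 1" and pos: "g2 (0, h) > 0"
  shows "locally_increasing h"
proof -
  define e where "e = g2 (0, h) / 2"
  have e: "e > 0" using pos by (simp add: e_def)
  obtain r2 where r2: "r2 > 0"
    "\<And>a b. 0 \<le> b \<Longrightarrow> b \<le> 1 \<Longrightarrow> \<bar>a - 0\<bar> < r2 \<Longrightarrow> \<bar>b - h\<bar> < r2 \<Longrightarrow> \<bar>g2 (a, b) - g2 (0, h)\<bar> < e"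
    using continuous_on_strip_box[OF cont(3) h e, of 0] by auto
  obtain r1 where r1: "r1 > 0"
    "\<And>a b. 0 \<le> b \<Longrightarrow> b \<le> 1 \<Longrightarrow> \<bar>a - 0\<bar> < r1 \<Longrightarrow> \<bar>b - h\<bar> < r1 \<Longrightarrow> \<bar>g1 (a, b) - g1 (0, h)\<bar> < 1"
    using continuous_on_strip_box[OF cont(2) h, of 1 0] by auto
  \<comment> \<open>A bound for \<open>g1\<close> near (0, h): values of m up to e / M change the
    derivative by at most e, half of \<open>g2 (0, h)\<close>.\<close>
  define M where "M = \<bar>g1 (0, h)\<bar> + 1"
  have M: "M > 0" by (simp add: M_def add_nonneg_pos)
  show ?thesis unfolding locally_increasing_def
  proof (rule exI[of _ "min r1 r2"], intro conjI exI[of _ "e / M"] allI impI)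
    fix a b m :: real
    assume *: "0 < b" "b < 1" "\<bar>a\<bar> < min r1 r2" "\<bar>b - h\<bar> < min r1 r2" "\<bar>m\<bar> \<le> e / M"
    have 1: "\<bar>g1 (a, b)\<bar> \<le> M" using r1(2)[of b a] * by (auto simp: M_def)
    have 2: "g2 (a, b) > e" using r2(2)[of b a] * by (auto simp: e_def abs_if split: if_splits)
    have "\<bar>m * g1 (a, b)\<bar> \<le> (e / M) * M" unfolding abs_mult using * 1 e M by (intro mult_mono) auto
    then show "m * g1 (a, b) + g2 (a, b) > 0" using 2 M by (simp add: abs_if split: if_splits)
  qed (use r1 r2 e M in auto)
qed

text \<open>
  If \<open>f 0 < 0\<close>, the Hopf lemma is not available at the bottom and the normal derivative may vanish
  there, but then the equation on the boundary gives \<open>g22 (0, 0) = - f 0 > 0\<close>.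
\<close>

lemma locally_increasing_bottom: "locally_increasing 0"
proof (cases "f 0 \<ge> 0")
  case True
  then show ?thesis using g2_bottom_pos[OF True] by (intro locally_increasing_pos) auto
next
  case False
  \<comment> \<open>Along the bottom u is constant, hence so is its tangential derivative; two
    applications remove \<open>g11\<close> from the equation there.\<close>
  have g1_0: "g1 (a, 0) = 0" for a
    by (rule tangential_derivative_zero[where F = u and A = g1 and B = g2]) (fact cont deriv_u bottom)+
  have g11_0: "g11 (a, 0) = 0" for a
    by (rule tangential_derivative_zero[where F = g1 and A = g11 and B = g12]) (fact cont deriv_g1 g1_0)+
  \<comment> \<open>The equation extends to the boundary by continuity, f being continuous on
    [0, c].\<close>
  define F where "F = (\<lambda>x. g11 x + g22 x + f (u x))"
  have f_cont: "continuous_on {0..c} f"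
    by (rule lipschitz_on_continuous_on[of L], rule lipschitz_onI)
      (use lipschitz L_pos in \<open>auto simp: dist_real_def\<close>)
  have "continuous_on (UNIV \<times> {0..1}) F" unfolding F_def
    using range_closed by (intro continuous_intros cont continuous_on_compose2[OF f_cont cont(1)]) auto
  then have F_cont: "continuous_on {0..1} (\<lambda>y. F (0, y))"
    by (rule continuous_on_compose2) (auto intro!: continuous_intros)
  have cl: "closure {0<..<1::real} = {0..1}" by simp
  have "F (0, 0) = 0"
  proof (rule continuous_constant_on_closure[of "{0<..<1}" "\<lambda>y. F (0, y)" 0 0])
    show "continuous_on (closure {0<..<1}) (\<lambda>y. F (0, y))" unfolding cl by (rule F_cont)
    show "F (0, y) = 0" if "y \<in> {0<..<1}" for y using pde[of "(0, y)"] that by (simp add: F_def)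
    show "0 \<in> closure {0<..<1::real}" unfolding cl by simp
  qed
  then have g22: "g22 (0, 0) > 0" using False by (simp add: F_def g11_0 bottom)
  define e where "e = g22 (0, 0) / 2"
  have e: "e > 0" using g22 by (simp add: e_def)
  obtain r2 where r2: "r2 > 0"
    "\<And>a b. 0 \<le> b \<Longrightarrow> b \<le> 1 \<Longrightarrow> \<bar>a - 0\<bar> < r2 \<Longrightarrow> \<bar>b - 0\<bar> < r2 \<Longrightarrow> \<bar>g22 (a, b) - g22 (0, 0)\<bar> < e"
    using continuous_on_strip_box[OF cont(7), of 0 e 0] e by auto
  obtain r1 where r1: "r1 > 0"
    "\<And>a b. 0 \<le> b \<Longrightarrow> b \<le> 1 \<Longrightarrow> \<bar>a - 0\<bar> < r1 \<Longrightarrow> \<bar>b - 0\<bar> < r1 \<Longrightarrow> \<bar>g12 (a, b) - g12 (0, 0)\<bar> < 1"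
    using continuous_on_strip_box[OF cont(5), of 0 1 0] by auto
  define M where "M = \<bar>g12 (0, 0)\<bar> + 1"
  have M: "M > 0" by (simp add: M_def add_nonneg_pos)
  show ?thesis unfolding locally_increasing_def
  proof (rule exI[of _ "min r1 r2"], intro conjI exI[of _ "e / M"] allI impI)
    fix a b m :: real
    assume *: "0 < b" "b < 1" "\<bar>a\<bar> < min r1 r2" "\<bar>b - 0\<bar> < min r1 r2" "\<bar>m\<bar> \<le> e / M"
    \<comment> \<open>Mean value theorem upwards from the bottom: the starting value is
      \<open>g2 (a, 0) \<ge> 0\<close>, since \<open>g1\<close> vanishes there, and the vertical
      derivative is positive.\<close>
    have "\<exists>\<xi>>0. \<xi> < b \<and>
      (m * g1 (a + b * 0, 0 + b * 1) + g2 (a + b * 0, 0 + b * 1)) - (m * g1 (a, 0) + g2 (a, 0)) =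
        b * ((m * g11 (a + \<xi> * 0, 0 + \<xi> * 1) + g21 (a + \<xi> * 0, 0 + \<xi> * 1)) * 0 +
             (m * g12 (a + \<xi> * 0, 0 + \<xi> * 1) + g22 (a + \<xi> * 0, 0 + \<xi> * 1)) * 1)"
    proof (rule segment_mvt[where F = "\<lambda>x. m * g1 x + g2 x" and A = "\<lambda>x. m * g11 x + g21 x" and B = "\<lambda>x. m * g12 x + g22 x"
          and T = b and b = 0 and q = 1 and a = a and p = 0])
      show "continuous_on (UNIV \<times> {0..1}) (\<lambda>x. m * g1 x + g2 x)" by (intro continuous_intros cont)
      fix x :: "real \<times> real" assume x: "0 < snd x" "snd x < 1"
      show "((\<lambda>x. m * g1 x + g2 x) has_derivative
          (\<lambda>h. (m * g11 x + g21 x) * fst h + (m * g12 x + g22 x) * snd h)) (at x)"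
        using has_derivative_add[OF has_derivative_mult_right[OF deriv_g1[OF x], of m] deriv_g2[OF x]]
        by (simp add: algebra_simps)
    qed (use * in auto)
    then obtain \<xi> where \<xi>: "0 < \<xi>" "\<xi> < b"
      "(m * g1 (a, b) + g2 (a, b)) - (m * g1 (a, 0) + g2 (a, 0)) = b * (m * g12 (a, \<xi>) + g22 (a, \<xi>))" by auto
    have 1: "\<bar>g12 (a, \<xi>)\<bar> \<le> M" using r1(2)[of \<xi> a] * \<xi> by (auto simp: M_def)
    have 2: "g22 (a, \<xi>) > e" using r2(2)[of \<xi> a] * \<xi> by (auto simp: e_def abs_if split: if_splits)
    have "\<bar>m * g12 (a, \<xi>)\<bar> \<le> (e / M) * M" unfolding abs_mult using * 1 e M by (intro mult_mono) auto
    then have "m * g12 (a, \<xi>) + g22 (a, \<xi>) > 0" using 2 M by (simp add: abs_if split: if_splits)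
    then have "b * (m * g12 (a, \<xi>) + g22 (a, \<xi>)) > 0" using * by simp
    then show "m * g1 (a, b) + g2 (a, b) > 0" using \<xi>(3) g2_bottom_nonneg[of a] by (simp add: g1_0)
  qed (use r1 r2 e M in auto)
qed

text \<open>Turning the strip upside down and replacing u by c - u exchanges the two boundary
  conditions and keeps the Lipschitz constant on [0, c]. It carries local monotonicity from the
  bottom to the top.\<close>

lemma flip:
  defines "\<sigma> \<equiv> \<lambda>x :: real \<times> real. (fst x, 1 - snd x)"
  shows "strip_solution (\<lambda>s. - f (c - s)) c L (\<lambda>x. c - u (\<sigma> x)) (\<lambda>x. - g1 (\<sigma> x)) (\<lambda>x. g2 (\<sigma> x))
    (\<lambda>x. - g11 (\<sigma> x)) (\<lambda>x. g12 (\<sigma> x)) (\<lambda>x. g21 (\<sigma> x)) (\<lambda>x. - g22 (\<sigma> x))"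
proof -
  have c\<sigma>: "continuous_on (UNIV \<times> {0..1}) (\<lambda>x. F (\<sigma> x))" if "continuous_on (UNIV \<times> {0..1}) F" for F :: "real \<times> real \<Rightarrow> real"
    using that unfolding \<sigma>_def by (rule continuous_on_compose2) (auto intro!: continuous_intros)
  have d\<sigma>: "(\<sigma> has_derivative (\<lambda>h. (fst h, - snd h))) (at x)" for x
    unfolding \<sigma>_def by (auto intro!: derivative_eq_intros)
  have s: "0 < snd (\<sigma> x)" "snd (\<sigma> x) < 1" if "0 < snd x" "snd x < 1" for x
    using that by (auto simp: \<sigma>_def)
  show ?thesis
  proof
    fix x :: "real \<times> real" assume x: "0 < snd x" "snd x < 1"
    have D: "((\<lambda>x. F (\<sigma> x)) has_derivative (\<lambda>h. P * fst h - Q * snd h)) (at x)"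
      if "(F has_derivative (\<lambda>h. P * fst h + Q * snd h)) (at (\<sigma> x))" for F :: "real \<times> real \<Rightarrow> real" and P Q
      using has_derivative_compose[OF d\<sigma> that] by simp
    show "((\<lambda>x. c - u (\<sigma> x)) has_derivative (\<lambda>h. - g1 (\<sigma> x) * fst h + g2 (\<sigma> x) * snd h)) (at x)"
      using has_derivative_diff[OF has_derivative_const[of c] D[OF deriv_u[OF s[OF x]]]] by simp
    show "((\<lambda>x. - g1 (\<sigma> x)) has_derivative (\<lambda>h. - g11 (\<sigma> x) * fst h + g12 (\<sigma> x) * snd h)) (at x)"
      using has_derivative_minus[OF D[OF deriv_g1[OF s[OF x]]]] by simp
    show "((\<lambda>x. g2 (\<sigma> x)) has_derivative (\<lambda>h. g21 (\<sigma> x) * fst h + - g22 (\<sigma> x) * snd h)) (at x)"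
      using D[OF deriv_g2[OF s[OF x]]] by simp
    show "- g11 (\<sigma> x) + - g22 (\<sigma> x) + - f (c - (c - u (\<sigma> x))) = 0" using pde[OF s[OF x]] by simp
    show "0 < c - u (\<sigma> x) \<and> c - u (\<sigma> x) < c" using range[OF s[OF x]] by simp
  next
    fix a b assume "a \<in> {0..c}" "b \<in> {0..c}"
    then show "\<bar>- f (c - a) - - f (c - b)\<bar> \<le> L * \<bar>a - b\<bar>"
      using lipschitz[of "c - a" "c - b"] by (auto simp: abs_minus_commute)
  qed (intro continuous_intros c\<sigma> cont L_pos c_pos | simp add: \<sigma>_def top bottom)+
qed

text \<open>Equation and boundary data ignore the orientation of x1, so results for x1 <= 0, or in
  the direction of increasing x1, come with mirror images.\<close>

lemma mirror:
  defines "\<mu> \<equiv> \<lambda>x :: real \<times> real. (- fst x, snd x)"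
  shows "strip_solution f c L (\<lambda>x. u (\<mu> x)) (\<lambda>x. - g1 (\<mu> x)) (\<lambda>x. g2 (\<mu> x))
    (\<lambda>x. g11 (\<mu> x)) (\<lambda>x. - g12 (\<mu> x)) (\<lambda>x. - g21 (\<mu> x)) (\<lambda>x. g22 (\<mu> x))"
proof -
  have c\<mu>: "continuous_on (UNIV \<times> {0..1}) (\<lambda>x. F (\<mu> x))" if "continuous_on (UNIV \<times> {0..1}) F" for F :: "real \<times> real \<Rightarrow> real"
    using that unfolding \<mu>_def by (rule continuous_on_compose2) (auto intro!: continuous_intros)
  have d\<mu>: "(\<mu> has_derivative (\<lambda>h. (- fst h, snd h))) (at x)" for x
    unfolding \<mu>_def by (auto intro!: derivative_eq_intros)
  have s: "0 < snd (\<mu> x)" "snd (\<mu> x) < 1" if "0 < snd x" "snd x < 1" for x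
    using that by (auto simp: \<mu>_def)
  show ?thesis
  proof
    fix x :: "real \<times> real" assume x: "0 < snd x" "snd x < 1"
    have D: "((\<lambda>x. F (\<mu> x)) has_derivative (\<lambda>h. Q * snd h - P * fst h)) (at x)"
      if "(F has_derivative (\<lambda>h. P * fst h + Q * snd h)) (at (\<mu> x))" for F :: "real \<times> real \<Rightarrow> real" and P Q
      using has_derivative_compose[OF d\<mu> that] by simp
    show "((\<lambda>x. u (\<mu> x)) has_derivative (\<lambda>h. - g1 (\<mu> x) * fst h + g2 (\<mu> x) * snd h)) (at x)"
      using D[OF deriv_u[OF s[OF x]]] by simp
    show "((\<lambda>x. - g1 (\<mu> x)) has_derivative (\<lambda>h. g11 (\<mu> x) * fst h + - g12 (\<mu> x) * snd h)) (at x)"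
      using has_derivative_minus[OF D[OF deriv_g1[OF s[OF x]]]] by simp
    show "((\<lambda>x. g2 (\<mu> x)) has_derivative (\<lambda>h. - g21 (\<mu> x) * fst h + g22 (\<mu> x) * snd h)) (at x)"
      using D[OF deriv_g2[OF s[OF x]]] by simp
    show "g11 (\<mu> x) + g22 (\<mu> x) + f (u (\<mu> x)) = 0" using pde[OF s[OF x]] by simp
    show "0 < u (\<mu> x) \<and> u (\<mu> x) < c" using range[OF s[OF x]] by simp
  qed (intro continuous_intros c\<mu> cont L_pos c_pos lipschitz | simp add: \<mu>_def top bottom)+
qed

end

lemma (in strip_solution) locally_increasing_top: "locally_increasing 1"
proof -
  from strip_solution.locally_increasing_bottom[OF flip, unfolded strip_solution.locally_increasing_def[OF flip]]
  obtain r \<delta> where r: "r > 0" "\<delta> > 0"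
    "\<And>a b m. 0 < b \<Longrightarrow> b < 1 \<Longrightarrow> \<bar>a\<bar> < r \<Longrightarrow> \<bar>b - 0\<bar> < r \<Longrightarrow> \<bar>m\<bar> \<le> \<delta> \<Longrightarrow>
      m * (- g1 (a, 1 - b)) + g2 (a, 1 - b) > 0"
    unfolding fst_conv snd_conv by blast
  show ?thesis unfolding locally_increasing_def
  proof (rule exI[of _ r], intro conjI exI[of _ \<delta>] allI impI)
    fix a b m :: real
    assume "0 < b" "b < 1" "\<bar>a\<bar> < r" "\<bar>b - 1\<bar> < r" "\<bar>m\<bar> \<le> \<delta>"
    \<comment> \<open>The flip changes the sign of \<open>g1\<close> but not of \<open>g2\<close>,
      hence - m.\<close>
    then show "m * g1 (a, b) + g2 (a, b) > 0" using r(3)[of "1 - b" a "- m"] by (simp add: abs_minus_commute)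
  qed (use r in auto)
qed

section \<open>Monotonicity in the second variable\<close>

context strip_solution
begin

definition side_positive :: "real \<Rightarrow> real \<Rightarrow> bool"
  where "side_positive s k \<longleftrightarrow> (\<forall>y<s. (0, y) \<in> cap k s \<longrightarrow> refl_diff k s (0, y) > 0)"

text \<open>Positivity for y < s degenerates as y tends to s; the derivative condition controls that
  end. Together they are stable under small changes of height and slope.\<close>

definition symmetric_increasing :: "real \<Rightarrow> bool"
  where "symmetric_increasing s \<longleftrightarrow> side_positive s 0 \<and> g2 (0, s) > 0"

text \<open>The segment from x to its image has direction (-k, 1), admissible in \<open>inc\<close>
  with m = - k, so the mean value theorem gives the sign.\<close>

lemma refl_diff_pos_near:
  assumes inc: "\<And>a b m. 0 < b \<Longrightarrow> b < 1 \<Longrightarrow> \<bar>a\<bar> < r \<Longrightarrow> \<bar>b - h\<bar> < r \<Longrightarrow> \<bar>m\<bar> \<le> \<delta> \<Longrightarrow> m * g1 (a, b) + g2 (a, b) > 0"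
    and x: "x \<in> cap k d" "gap k d x > 0" and k: "\<bar>k\<bar> \<le> \<delta>"
    and near: "\<bar>fst x\<bar> < r" "\<bar>snd x - h\<bar> < r" "\<bar>fst (refl_line k d x)\<bar> < r" "\<bar>snd (refl_line k d x) - h\<bar> < r"
  shows "refl_diff k d x > 0"
proof -
  define T where "T = 2 * gap k d x / (1 + k\<^sup>2)"
  have T: "T > 0" using x(2) one_plus_square_pos[of k] by (simp add: T_def)
  have rx: "refl_line k d x = (fst x + T * (- k), snd x + T * 1)"
    by (simp add: refl_line_def T_def)
  note s = cap_snd[OF x(1)]
  have "\<exists>\<xi>>0. \<xi> < T \<and> u (fst x + T * (- k), snd x + T * 1) - u (fst x, snd x) =
      T * (g1 (fst x + \<xi> * (- k), snd x + \<xi> * 1) * (- k) + g2 (fst x + \<xi> * (- k), snd x + \<xi> * 1) * 1)"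
    by (rule segment_mvt[where F = u and A = g1 and B = g2 and T = T and b = "snd x" and q = 1
          and a = "fst x" and p = "- k"])
      (fact cont(1), erule (1) deriv_u, use T s in \<open>auto simp: rx\<close>)
  then obtain \<xi> where \<xi>: "0 < \<xi>" "\<xi> < T" "refl_diff k d x =
      T * (- k * g1 (fst x + \<xi> * (- k), snd x + \<xi>) + g2 (fst x + \<xi> * (- k), snd x + \<xi>))"
    by (auto simp: refl_diff_def rx mult.commute)
  have box: "\<bar>a + \<xi> * p\<bar> < r" if "\<bar>a\<bar> < r" "\<bar>a + T * p\<bar> < r" for a p :: real
  proof -
    define v where "v = \<xi> / T"
    have v: "0 \<le> v" "v \<le> 1" "\<xi> = v * T" using \<xi> T by (auto simp: v_def)
    have "a + \<xi> * p = (1 - v) * a + v * (a + T * p)" using v(3) by (simp add: algebra_simps)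
    moreover have "(1 - v) * a + v * (a + T * p) < r" using that v by (intro convex_bound_lt) auto
    moreover have "(1 - v) * a + v * (a + T * p) > - r" using that v by (intro affine_gt) auto
    ultimately show ?thesis by linarith
  qed
  have "- k * g1 (fst x + \<xi> * (- k), snd x + \<xi>) + g2 (fst x + \<xi> * (- k), snd x + \<xi>) > 0"
  proof (rule inc)
    show "0 < snd x + \<xi>" "snd x + \<xi> < 1" using s \<xi> by (auto simp: rx)
    show "\<bar>fst x + \<xi> * (- k)\<bar> < r" using near(1,3) by (intro box) (auto simp: rx)
    show "\<bar>snd x + \<xi> - h\<bar> < r" using box[of "snd x - h" 1] near(2,4) by (simp add: rx algebra_simps)
    show "\<bar>- k\<bar> \<le> \<delta>" using k by simp
  qed
  then show ?thesis using \<xi>(3) T by simp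
qed

text \<open>Violations at heights tending to s0 and slopes tending to 0 have a limit point (0, Y).
  If Y < s0, positivity at s0 excludes it; if Y = s0, points and images both approach (0, s0), where
  monotonicity in nearly vertical directions excludes the violations themselves.\<close>

lemma side_positive_near:
  assumes s0: "0 \<le> s0" "s0 \<le> 1" and inc: "locally_increasing s0" and side: "side_positive s0 0"
  shows "\<exists>\<eta>>0. \<forall>s k. \<bar>s - s0\<bar> < \<eta> \<longrightarrow> 0 \<le> k \<longrightarrow> k < \<eta> \<longrightarrow> side_positive s k"
proof (rule ccontr)
  assume contr: "\<not> ?thesis"
  have "\<exists>s k y. \<bar>s - s0\<bar> < inverse (Suc n) \<and> 0 \<le> k \<and> k < inverse (Suc n) \<and>
      y < s \<and> (0, y) \<in> cap k s \<and> \<not> refl_diff k s (0, y) > 0" for n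
  proof -
    have "inverse (real (Suc n)) > 0" by simp
    with contr show ?thesis unfolding side_positive_def by blast
  qed
  then obtain s k y where *: "\<And>n. \<bar>s n - s0\<bar> < inverse (Suc n)" "\<And>n. 0 \<le> k n" "\<And>n. k n < inverse (Suc n)"
      "\<And>n. y n < s n" "\<And>n. (0, y n) \<in> cap (k n) (s n)" "\<And>n. \<not> refl_diff (k n) (s n) (0, y n) > 0"
    by metis
  have inv: "(\<lambda>n. inverse (real (Suc n))) \<longlonglongrightarrow> 0" by (rule LIMSEQ_inverse_real_of_nat)
  have "(\<lambda>n. s n - s0) \<longlonglongrightarrow> 0"
    by (rule Lim_null_comparison[OF _ inv]) (use *(1) in \<open>auto simp: less_imp_le\<close>)
  then have ls: "s \<longlonglongrightarrow> s0" by (simp add: LIM_zero_iff)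
  have lk: "k \<longlonglongrightarrow> 0"
    by (rule Lim_null_comparison[OF _ inv]) (use *(2,3) in \<open>auto simp: less_imp_le\<close>)
  have "y n \<in> {0..1}" for n using cap_snd[OF *(5)[of n]] by simp
  moreover have "compact {0..1::real}" by simp
  ultimately obtain Y r where r: "strict_mono r" "(y \<circ> r) \<longlonglongrightarrow> Y"
    unfolding compact_def by metis
  have lim: "(\<lambda>n. s (r n)) \<longlonglongrightarrow> s0" "(\<lambda>n. k (r n)) \<longlonglongrightarrow> 0" "(\<lambda>n. (0, y (r n))) \<longlonglongrightarrow> (0, Y)"
    using LIMSEQ_subseq_LIMSEQ[OF ls r(1)] LIMSEQ_subseq_LIMSEQ[OF lk r(1)] r(2)
    by (auto simp: o_def intro: tendsto_intros)
  have Y: "(0, Y) \<in> cap 0 s0"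
    by (rule cap_limit[OF lim(2,1,3)]) (auto simp: *)
  have wY: "refl_diff 0 s0 (0, Y) \<le> 0"
    by (rule tendsto_upperbound[OF tendsto_refl_diff[OF lim(2,1,3) _ Y]]) (use * in \<open>auto simp: not_less\<close>)
  have "Y \<le> s0" using Y by (simp add: cap_def gap_def)
  then have "Y = s0" using side Y wY unfolding side_positive_def by force
  obtain \<rho> \<delta> where inc: "\<rho> > 0" "\<delta> > 0"
    "\<And>a b m. 0 < b \<Longrightarrow> b < 1 \<Longrightarrow> \<bar>a\<bar> < \<rho> \<Longrightarrow> \<bar>b - s0\<bar> < \<rho> \<Longrightarrow> \<bar>m\<bar> \<le> \<delta> \<Longrightarrow> m * g1 (a, b) + g2 (a, b) > 0"
    using inc unfolding locally_increasing_def by blast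
  have "refl_line 0 s0 (0, Y) = (0, s0)" by (simp add: refl_line_def gap_def \<open>Y = s0\<close>)
  then have lr: "(\<lambda>n. refl_line (k (r n)) (s (r n)) (0, y (r n))) \<longlonglongrightarrow> (0, s0)"
    using tendsto_refl_line[OF lim(2,1,3)] by simp
  have ly: "(\<lambda>n. y (r n)) \<longlonglongrightarrow> s0" using tendsto_snd[OF lim(3)] \<open>Y = s0\<close> by simp
  have close: "\<forall>\<^sub>F n in sequentially. \<bar>p n - l\<bar> < e" if "p \<longlonglongrightarrow> l" "e > 0" for p :: "nat \<Rightarrow> real" and l e
    using tendstoD[OF that] by (simp add: dist_real_def)
  have "\<forall>\<^sub>F n in sequentially. False"
    using close[OF ly inc(1)] close[OF tendsto_fst[OF lr] inc(1)] close[OF tendsto_snd[OF lr] inc(1)] close[OF lim(2) inc(2)]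
  proof eventually_elim
    case (elim n)
    have "refl_diff (k (r n)) (s (r n)) (0, y (r n)) > 0"
      by (rule refl_diff_pos_near[OF inc(3)]) (use elim * inc(1) in \<open>auto simp: gap_def\<close>)
    then show False using *(6) by blast
  qed
  then show False by simp
qed

text \<open>Compactness of [a, b] by bisection: the property passes from two adjacent intervals to
  their union and holds on short ones.\<close>

lemma side_positive_uniform:
  assumes ab: "a \<le> b"
    and near: "\<And>s0. a \<le> s0 \<Longrightarrow> s0 \<le> b \<Longrightarrow> \<exists>\<eta>>0. \<forall>s k. \<bar>s - s0\<bar> < \<eta> \<longrightarrow> 0 \<le> k \<longrightarrow> k < \<eta> \<longrightarrow> side_positive s k"
  shows "\<exists>\<delta>>0. \<forall>s k. a \<le> s \<longrightarrow> s \<le> b \<longrightarrow> 0 \<le> k \<longrightarrow> k < \<delta> \<longrightarrow> side_positive s k"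
  using ab
proof (induction rule: Bolzano)
  case (trans a b c)
  then obtain \<delta>1 \<delta>2 where "\<delta>1 > 0" "\<delta>2 > 0"
    "\<And>s k. a \<le> s \<Longrightarrow> s \<le> b \<Longrightarrow> 0 \<le> k \<Longrightarrow> k < \<delta>1 \<Longrightarrow> side_positive s k"
    "\<And>s k. b \<le> s \<Longrightarrow> s \<le> c \<Longrightarrow> 0 \<le> k \<Longrightarrow> k < \<delta>2 \<Longrightarrow> side_positive s k" by metis
  then show ?case by (intro exI[of _ "min \<delta>1 \<delta>2"]) (auto, meson linear)
next
  case (local x)
  then obtain \<eta> where \<eta>: "\<eta> > 0" "\<And>s k. \<bar>s - x\<bar> < \<eta> \<Longrightarrow> 0 \<le> k \<Longrightarrow> k < \<eta> \<Longrightarrow> side_positive s k"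
    using near by metis
  show ?case
  proof (intro exI[of _ \<eta>] conjI allI impI \<eta>(1))
    fix a' b' s k :: real
    assume "a' \<le> x \<and> x \<le> b' \<and> b' - a' < \<eta>" "a' \<le> s" "s \<le> b'" "0 \<le> k" "k < \<eta>"
    then show "side_positive s k" by (intro \<eta>(2)) auto
  qed
qed

section \<open>Horizontal lines as limits of tilted lines\<close>

lemma sweep_upwards:
  assumes k: "k > 0" and side: "\<And>s'. 0 \<le> s' \<Longrightarrow> s' \<le> s \<Longrightarrow> side_positive s' k" and s: "s \<ge> 0"
    and x: "x \<in> cap k s" "fst x \<le> 0"
  shows "refl_diff k s x \<ge> 0"
proof (rule sweep[where ?k0.0 = k and ?k1.0 = k and ?d0.0 = 0 and ?d1.0 = s and b = 0])
  fix y assume y: "y \<in> cap k 0" "fst y \<le> 0"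
  \<comment> \<open>At height 0 the truncated triangle lies on the line, since both terms of the gap
    are nonpositive.\<close>
  have "k * fst y \<le> 0" using k y by (simp add: mult_nonneg_nonpos)
  then have "gap k 0 y = 0" using y by (auto simp: cap_def gap_def)
  then show "refl_diff k 0 y \<ge> 0" by (simp add: refl_diff_gap_0)
next
  fix t y
  assume t: "0 \<le> t" "t \<le> (1::real)" and y: "y \<in> cap (k + t * (k - k)) (0 + t * (s - 0))" "fst y = 0"
    "gap (k + t * (k - k)) (0 + t * (s - 0)) y > 0"
  have "t * s \<le> s" using t s by (simp add: mult_left_le_one_le)
  then have "side_positive (t * s) k" using t s by (intro side) auto
  then show "refl_diff (k + t * (k - k)) (0 + t * (s - 0)) y > 0"
    using y unfolding side_positive_def by (cases y) (auto simp: gap_def)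
qed (use k x in auto)

text \<open>Two limits are taken in turn. A uniform range of slopes is available on [0, s] for s <
  \<sigma> only, nothing being known yet at \<sigma>; so the slope first tends to 0 at fixed s, then
  s tends to \<sigma> from below.\<close>

lemma moving_plane_left:
  assumes \<sigma>: "0 < \<sigma>" "\<sigma> < 1" and below: "\<And>s. 0 < s \<Longrightarrow> s < \<sigma> \<Longrightarrow> symmetric_increasing s"
    and x: "x \<in> cap_interior 0 \<sigma>" "fst x \<le> 0"
  shows "refl_diff 0 \<sigma> x \<ge> 0"
proof -
  have step: "refl_diff 0 s x \<ge> 0" if s: "0 < s" "s < \<sigma>" and xs: "x \<in> cap_interior 0 s" for s
  proof -
    have "\<exists>\<delta>>0. \<forall>s' k. 0 \<le> s' \<longrightarrow> s' \<le> s \<longrightarrow> 0 \<le> k \<longrightarrow> k < \<delta> \<longrightarrow> side_positive s' k"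
    proof (rule side_positive_uniform)
      fix s0 assume s0: "0 \<le> s0" "s0 \<le> s"
      show "\<exists>\<eta>>0. \<forall>s k. \<bar>s - s0\<bar> < \<eta> \<longrightarrow> 0 \<le> k \<longrightarrow> k < \<eta> \<longrightarrow> side_positive s k"
      proof (rule side_positive_near)
        show "locally_increasing s0"
          using locally_increasing_bottom locally_increasing_pos[of s0] below[of s0] s0 s \<sigma>
          by (cases "s0 = 0") (auto simp: symmetric_increasing_def)
        show "side_positive s0 0"
          \<comment> \<open>At height 0 the condition is void: points of the cap have y >=
            0.\<close>
          using below[of s0] s0 s by (cases "s0 = 0") (auto simp: symmetric_increasing_def side_positive_def cap_def)
      qed (use s0 s \<sigma> in auto)
    qed (use s in simp)
    then obtain \<delta> where \<delta>: "\<delta> > 0" "\<And>s' k. 0 \<le> s' \<Longrightarrow> s' \<le> s \<Longrightarrow> 0 \<le> k \<Longrightarrow> k < \<delta> \<Longrightarrow> side_positive s' k" by blast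
    define F where "F = at_right (0 :: real)"
    have lim: "((\<lambda>k. k) \<longlongrightarrow> 0) F" by (simp add: F_def tendsto_ident_at)
    have "\<forall>\<^sub>F k in F. k \<in> {0<..<\<delta>}" unfolding F_def using \<delta> by (intro eventually_at_right_real) auto
    moreover have "\<forall>\<^sub>F k in F. 0 < gap k s x" "\<forall>\<^sub>F k in F. snd (refl_line k s x) < 1"
      using xs by (auto intro!: order_tendstoD[OF tendsto_gap[OF lim tendsto_const tendsto_const]]
        order_tendstoD[OF tendsto_snd[OF tendsto_refl_line[OF lim tendsto_const tendsto_const]]] simp: cap_interior_def)
    ultimately have ev: "\<forall>\<^sub>F k in F. x \<in> cap k s \<and> refl_diff k s x \<ge> 0"
    proof eventually_elim
      case (elim k)
      then have c: "x \<in> cap k s" using xs by (auto simp: cap_def cap_interior_def)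
      moreover have "refl_diff k s x \<ge> 0" using elim \<delta>(2) c x s by (intro sweep_upwards) auto
      ultimately show ?case by simp
    qed
    have xc: "x \<in> cap 0 s" using xs cap_interior_subset by blast
    have "((\<lambda>k. refl_diff k s x) \<longlongrightarrow> refl_diff 0 s x) F"
      using ev by (intro tendsto_refl_diff[OF lim tendsto_const tendsto_const _ xc]) (auto elim: eventually_mono)
    then show ?thesis
      by (rule tendsto_lowerbound) (use ev in \<open>auto elim: eventually_mono simp: F_def\<close>)
  qed
  define F where "F = at_left \<sigma>"
  have lim: "((\<lambda>s. s) \<longlongrightarrow> \<sigma>) F" by (simp add: F_def tendsto_ident_at)
  have "\<forall>\<^sub>F s in F. s \<in> {0<..<\<sigma>}" unfolding F_def using \<sigma> by (intro eventually_at_left_real) auto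
  moreover have "\<forall>\<^sub>F s in F. 0 < gap 0 s x" "\<forall>\<^sub>F s in F. snd (refl_line 0 s x) < 1"
    using x by (auto intro!: order_tendstoD[OF tendsto_gap[OF tendsto_const lim tendsto_const]]
      order_tendstoD[OF tendsto_snd[OF tendsto_refl_line[OF tendsto_const lim tendsto_const]]] simp: cap_interior_def)
  ultimately have ev: "\<forall>\<^sub>F s in F. x \<in> cap 0 s \<and> refl_diff 0 s x \<ge> 0"
  proof eventually_elim
    case (elim s)
    then have "x \<in> cap_interior 0 s" using x by (auto simp: cap_interior_def)
    then show ?case using step[of s] elim cap_interior_subset by auto
  qed
  have xc: "x \<in> cap 0 \<sigma>" using x cap_interior_subset by blast
  have "((\<lambda>s. refl_diff 0 s x) \<longlongrightarrow> refl_diff 0 \<sigma> x) F"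
    using ev by (intro tendsto_refl_diff[OF tendsto_const lim tendsto_const _ xc]) (auto elim: eventually_mono)
  then show ?thesis
    by (rule tendsto_lowerbound) (use ev in \<open>auto elim: eventually_mono simp: F_def\<close>)
qed

text \<open>Hopf lemma in a disc that touches the line from below at (0, \<sigma>). The difference
  at distance t compares two points 2 t apart, so growth at rate \<kappa> makes \<open>g2\<close>
  reach \<kappa> / 2 arbitrarily close to (0, \<sigma>).\<close>

lemma g2_pos_at_symmetry_line:
  assumes \<sigma>: "0 < \<sigma>" "\<sigma> < 1" and pos: "\<And>x. x \<in> cap_interior 0 \<sigma> \<Longrightarrow> refl_diff 0 \<sigma> x > 0"
  shows "g2 (0, \<sigma>) > 0"
proof -
  \<comment> \<open>The disc of radius r around (0, \<sigma> - r) then fits in the cap: it does not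
    pass the bottom, nor does its image pass the top.\<close>
  define r where "r = min \<sigma> (1 - \<sigma>) / 2"
  have r: "r > 0" "2 * r \<le> \<sigma>" "2 * r \<le> 1 - \<sigma>" using \<sigma> by (auto simp: r_def)
  define q where "q = (0 :: real, \<sigma> - r)"
  have snd_q: "\<bar>snd x - (\<sigma> - r)\<bar> \<le> dist q x" for x
    using dist_snd_le[of q x] by (simp add: q_def dist_real_def abs_minus_commute)
  have g: "gap 0 \<sigma> x = \<sigma> - snd x" "snd (refl_line 0 \<sigma> x) = 2 * \<sigma> - snd x" for x
    by (auto simp: gap_def refl_line_def)
  have cball: "x \<in> cap 0 \<sigma>" if "dist q x \<le> r" for x
    using snd_q[of x] that r by (auto simp: cap_def g abs_if split: if_splits)
  have ball: "x \<in> cap_interior 0 \<sigma>" if "dist q x < r" for x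
    using snd_q[of x] that r by (auto simp: cap_interior_def g abs_if split: if_splits)
  have "\<exists>\<kappa>>0. \<forall>x. r / 2 \<le> dist q x \<longrightarrow> dist q x \<le> r \<longrightarrow> refl_diff 0 \<sigma> x \<ge> \<kappa> * (r - dist q x)"
  proof (rule hopf)
    show "continuous_on (cball q r) (refl_diff 0 \<sigma>)"
      using cball by (intro continuous_on_subset[OF continuous_on_refl_diff] subsetI) auto
    show "refl_diff 0 \<sigma> x \<ge> 0" if "x \<in> cball q r" for x
    proof -
      have x: "x \<in> cap 0 \<sigma>" using cball that by simp
      then consider "gap 0 \<sigma> x = 0" | "gap 0 \<sigma> x > 0" by (force simp: cap_def)
      then show ?thesis
        using refl_diff_gap_0[of 0 \<sigma> x] refl_diff_pos_boundary[OF x] pos[of x] by cases force+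
    qed
    show "\<exists>l. has_laplacian (refl_diff 0 \<sigma>) x l \<and> l \<le> L * refl_diff 0 \<sigma> x" if "x \<in> ball q r" for x
    proof -
      have x: "x \<in> cap_interior 0 \<sigma>" using ball that by simp
      then obtain l where "has_laplacian (refl_diff 0 \<sigma>) x l" "l \<le> L * \<bar>refl_diff 0 \<sigma> x\<bar>" by (rule has_laplacian_refl_diff)
      then show ?thesis using pos[OF x] by auto
    qed
    show "refl_diff 0 \<sigma> x > 0" if "x \<in> cball q (r / 2)" for x using that r by (intro pos ball) auto
  qed (use r L_pos in auto)
  then obtain \<kappa> where \<kappa>: "\<kappa> > 0"
    "\<And>x. r / 2 \<le> dist q x \<Longrightarrow> dist q x \<le> r \<Longrightarrow> refl_diff 0 \<sigma> x \<ge> \<kappa> * (r - dist q x)" by blast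
  show ?thesis
  proof (rule ccontr)
    assume neg: "\<not> g2 (0, \<sigma>) > 0"
    have "\<kappa> / 2 > 0" using \<kappa> by simp
    then obtain e where e: "e > 0"
      "\<And>a b. 0 \<le> b \<Longrightarrow> b \<le> 1 \<Longrightarrow> \<bar>a - 0\<bar> < e \<Longrightarrow> \<bar>b - \<sigma>\<bar> < e \<Longrightarrow> \<bar>g2 (a, b) - g2 (0, \<sigma>)\<bar> < \<kappa> / 2"
      using continuous_on_strip_box[OF cont(3), of \<sigma> "\<kappa> / 2" 0] \<sigma> by auto
    define t where "t = min (r / 2) (e / 2)"
    have t: "0 < t" "t \<le> r / 2" "t < e" using r e by (auto simp: t_def)
    have "dist q (0, \<sigma> - t) = r - t" using t by (simp add: q_def dist_Pair_Pair dist_real_def)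
    then have "refl_diff 0 \<sigma> (0, \<sigma> - t) \<ge> \<kappa> * t" using \<kappa>(2)[of "(0, \<sigma> - t)"] t by simp
    moreover have "refl_line 0 \<sigma> (0, \<sigma> - t) = (0, \<sigma> + t)" by (simp add: refl_line_def gap_def)
    ultimately have 1: "u (0, \<sigma> + t) - u (0, \<sigma> - t) \<ge> \<kappa> * t" by (simp add: refl_diff_def)
    obtain \<xi> where \<xi>: "\<sigma> - t < \<xi>" "\<xi> < \<sigma> + t" "u (0, \<sigma> + t) - u (0, \<sigma> - t) = (\<sigma> + t - (\<sigma> - t)) * g2 (0, \<xi>)"
      using vertical_mvt[of "\<sigma> - t" "\<sigma> + t" 0] t r \<sigma> by auto
    have "t * (\<kappa> / 2) \<le> t * g2 (0, \<xi>)" using 1 \<xi>(3) by (simp add: algebra_simps)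
    then have "\<kappa> / 2 \<le> g2 (0, \<xi>)" using t by (simp add: mult_le_cancel_left_pos)
    moreover have "\<bar>g2 (0, \<xi>) - g2 (0, \<sigma>)\<bar> < \<kappa> / 2" using e(2)[of \<xi> 0] \<xi> t r by auto
    ultimately show False using neg by linarith
  qed
qed

end

text \<open>The predicate only sees the line x1 = 0, which the mirror fixes. So the hypothesis holds
  for the mirrored solution too, and the right half follows from the left.\<close>

lemma (in strip_solution) symmetric_increasing_step:
  assumes \<sigma>: "0 < \<sigma>" "\<sigma> < 1" and below: "\<And>s. 0 < s \<Longrightarrow> s < \<sigma> \<Longrightarrow> symmetric_increasing s"
  shows "symmetric_increasing \<sigma>"
proof -
  interpret m: strip_solution f c L "\<lambda>x. u (- fst x, snd x)" "\<lambda>x. - g1 (- fst x, snd x)" "\<lambda>x. g2 (- fst x, snd x)"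
    "\<lambda>x. g11 (- fst x, snd x)" "\<lambda>x. - g12 (- fst x, snd x)" "\<lambda>x. - g21 (- fst x, snd x)" "\<lambda>x. g22 (- fst x, snd x)"
    by (rule mirror)
  have mw: "m.refl_diff 0 s x = refl_diff 0 s (- fst x, snd x)" for s x
    by (simp add: m.refl_diff_def refl_diff_def refl_line_def gap_def)
  have ms: "m.symmetric_increasing s = symmetric_increasing s" for s
    by (simp add: m.symmetric_increasing_def symmetric_increasing_def m.side_positive_def side_positive_def mw)
  have nonneg: "refl_diff 0 \<sigma> x \<ge> 0" if x: "x \<in> cap_interior 0 \<sigma>" for x
  proof (cases "fst x \<le> 0")
    case True
    then show ?thesis using moving_plane_left[OF \<sigma> below x] by blast
  next
    case False
    have "(- fst x, snd x) \<in> cap_interior 0 \<sigma>" using x by (auto simp: cap_interior_def gap_def refl_line_def)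
    then have "m.refl_diff 0 \<sigma> (- fst x, snd x) \<ge> 0"
      using False by (intro m.moving_plane_left[OF \<sigma>]) (auto simp: ms below)
    then show ?thesis by (simp add: mw)
  qed
  \<comment> \<open>The cut at \<open>fst x + 1\<close> is harmless, as nonnegativity holds in the
    whole interior of the cap.\<close>
  have pos: "refl_diff 0 \<sigma> x > 0" if "x \<in> cap_interior 0 \<sigma>" for x
    using cap_interior_pos[of 0 \<sigma> "fst x + 1" x] nonneg that by simp
  have "refl_diff 0 \<sigma> (0, y) > 0" if "y < \<sigma>" "(0, y) \<in> cap 0 \<sigma>" for y
    using refl_diff_pos_boundary[OF that(2)] pos[of "(0, y)"] that(1)
    by (cases "(0, y) \<in> cap_interior 0 \<sigma>") (auto simp: gap_def)
  then show ?thesis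
    using g2_pos_at_symmetry_line[OF \<sigma> pos] by (simp add: symmetric_increasing_def side_positive_def)
qed

context strip_solution
begin

section \<open>Continuation in the height of the line\<close>

lemma symmetric_increasing_near:
  assumes s0: "0 \<le> s0" "s0 \<le> 1" and inc: "locally_increasing s0" and side: "side_positive s0 0"
  shows "\<exists>\<eta>>0. \<forall>s. \<bar>s - s0\<bar> < \<eta> \<longrightarrow> 0 < s \<longrightarrow> s < 1 \<longrightarrow> symmetric_increasing s"
proof -
  obtain \<eta> where \<eta>: "\<eta> > 0" "\<And>s k. \<bar>s - s0\<bar> < \<eta> \<Longrightarrow> 0 \<le> k \<Longrightarrow> k < \<eta> \<Longrightarrow> side_positive s k"
    using side_positive_near[OF assms] by blast
  obtain r \<delta> where r: "r > 0" "\<delta> > 0"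
    "\<And>a b m. 0 < b \<Longrightarrow> b < 1 \<Longrightarrow> \<bar>a\<bar> < r \<Longrightarrow> \<bar>b - s0\<bar> < r \<Longrightarrow> \<bar>m\<bar> \<le> \<delta> \<Longrightarrow> m * g1 (a, b) + g2 (a, b) > 0"
    using inc unfolding locally_increasing_def by blast
  have "symmetric_increasing s" if "\<bar>s - s0\<bar> < min \<eta> r" "0 < s" "s < 1" for s
    using \<eta>(2)[of s 0] r(3)[of s 0 0] that \<eta>(1) r(1,2) by (simp add: symmetric_increasing_def)
  then show ?thesis using \<eta>(1) r(1) by (intro exI[of _ "min \<eta> r"]) auto
qed

text \<open>The infimum of the bad heights cannot be 0, by stability at the bottom; if positive, it
  would itself be good, and so would all heights slightly above it.\<close>

lemma symmetric_increasing:
  assumes "0 < s" "s < 1"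
  shows "symmetric_increasing s"
proof (rule ccontr)
  assume "\<not> symmetric_increasing s"
  define Bad where "Bad = {s. 0 < s \<and> s < 1 \<and> \<not> symmetric_increasing s}"
  have sB: "s \<in> Bad" using assms \<open>\<not> symmetric_increasing s\<close> by (simp add: Bad_def)
  have bdd: "bdd_below Bad" by (rule bdd_belowI[of _ 0]) (simp add: Bad_def)
  define \<sigma> where "\<sigma> = Inf Bad"
  have "\<sigma> \<le> s" using sB bdd by (auto simp: \<sigma>_def intro: cInf_lower)
  then have \<sigma>1: "\<sigma> < 1" using assms by simp
  have below: "symmetric_increasing t" if "0 < t" "t < \<sigma>" for t
    using cInf_lower[OF _ bdd, of t] that \<sigma>1 by (force simp: \<sigma>_def Bad_def)
  have near: "\<exists>\<eta>>0. \<forall>s. \<bar>s - s0\<bar> < \<eta> \<longrightarrow> 0 < s \<longrightarrow> s < 1 \<longrightarrow> symmetric_increasing s"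
    if "s0 = 0 \<or> 0 < s0 \<and> s0 < 1 \<and> symmetric_increasing s0" for s0
  proof (rule symmetric_increasing_near)
    show "locally_increasing s0"
      using that locally_increasing_bottom locally_increasing_pos[of s0] by (auto simp: symmetric_increasing_def)
    show "side_positive s0 0" using that by (auto simp: symmetric_increasing_def side_positive_def cap_def)
  qed (use that in auto)
  have contr: False if "\<eta> > 0" "\<And>t. 0 < t \<Longrightarrow> t < \<sigma> + \<eta> \<Longrightarrow> t < 1 \<Longrightarrow> symmetric_increasing t" for \<eta>
  proof -
    have "\<sigma> + \<eta> \<le> Inf Bad"
    proof (rule cInf_greatest)
      fix t assume t: "t \<in> Bad"
      show "\<sigma> + \<eta> \<le> t"
      proof (rule ccontr)
        assume "\<not> \<sigma> + \<eta> \<le> t"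
        then show False using that(2)[of t] t by (auto simp: Bad_def)
      qed
    qed (use sB in auto)
    then show False using that(1) by (simp add: \<sigma>_def)
  qed
  have "\<sigma> \<ge> 0" using sB by (auto simp: \<sigma>_def Bad_def intro!: cInf_greatest)
  then consider "\<sigma> = 0" | "\<sigma> > 0" by linarith
  then show False
  proof cases
    case 1
    then show False using near[of 0] contr by (metis abs_of_pos diff_zero add_0)
  next
    case 2
    have "symmetric_increasing \<sigma>" using symmetric_increasing_step[OF 2 \<sigma>1 below] .
    then obtain \<eta> where \<eta>: "\<eta> > 0" "\<And>s. \<bar>s - \<sigma>\<bar> < \<eta> \<Longrightarrow> 0 < s \<Longrightarrow> s < 1 \<Longrightarrow> symmetric_increasing s"
      using near[of \<sigma>] 2 \<sigma>1 by blast
    have "symmetric_increasing t" if "0 < t" "t < \<sigma> + \<eta>" "t < 1" for t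
      using below[of t] \<eta>(2)[of t] that by (cases "t < \<sigma>") auto
    then show False using contr[OF \<eta>(1)] by blast
  qed
qed

end

section \<open>Rotation to a vertical line\<close>

text \<open>On the right the reflected top closes the triangle: an image height of at most 1 limits
  the gap to (1 + k^2) / 2, whereas the gap grows like k x1. The bound is uniform along a
  sweep.\<close>

lemma cap_bounded_right:
  assumes k: "0 < kmin" "kmin \<le> k" "k \<le> kmax" and d: "\<bar>d\<bar> \<le> M" and x: "x \<in> cap k d"
  shows "fst x \<le> ((1 + kmax\<^sup>2) / 2 + M + 1) / kmin"
proof (cases "fst x \<ge> 0")
  case True
  note s = cap_snd[OF x]
  define q where "q = kmax\<^sup>2"
  have "2 * gap k d x / (1 + k\<^sup>2) \<le> 1" using s by (simp add: refl_line_def)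
  then have "2 * gap k d x \<le> 1 + k\<^sup>2" using one_plus_square_pos[of k] by (simp add: pos_divide_le_eq)
  moreover have "k\<^sup>2 \<le> q" unfolding q_def using k by (intro power_mono) auto
  ultimately have "2 * gap k d x \<le> 1 + q" by linarith
  moreover have "gap k d x \<ge> k * fst x - M - 1" using s d by (simp add: gap_def)
  ultimately have "k * fst x \<le> (1 + q) / 2 + M + 1" by argo
  moreover have "kmin * fst x \<le> k * fst x" using k True by (intro mult_right_mono) auto
  ultimately show ?thesis using k unfolding q_def by (simp add: pos_le_divide_eq mult.commute)
next
  case False
  have "((1 + kmax\<^sup>2) / 2 + M + 1) / kmin \<ge> 0" using k d by simp
  with False show ?thesis by linarith
qed

context strip_solution
begin

text \<open>The upward sweep with the cut at x1 = 0 reaches intercept 1, and for a slope below 1 the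
  whole triangle there lies in x1 <= 0. So the cut removes nothing.\<close>

lemma full_triangle:
  obtains \<delta> where "\<delta> > 0" "\<And>x. x \<in> cap \<delta> 1 \<Longrightarrow> refl_diff \<delta> 1 x \<ge> 0"
proof -
  have "\<exists>\<delta>>0. \<forall>s k. 0 \<le> s \<longrightarrow> s \<le> 1 \<longrightarrow> 0 \<le> k \<longrightarrow> k < \<delta> \<longrightarrow> side_positive s k"
  proof (rule side_positive_uniform)
    fix s0 :: real assume s0: "0 \<le> s0" "s0 \<le> 1"
    then consider "s0 = 0" | "s0 = 1" | "0 < s0" "s0 < 1" by linarith
    then have "locally_increasing s0 \<and> side_positive s0 0"
    proof cases
      case 1
      then show ?thesis using locally_increasing_bottom by (auto simp: side_positive_def cap_def)
    next
      case 2
      \<comment> \<open>At height 1 the side condition is void: a point below the horizontal line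
        has its image above the top.\<close>
      then show ?thesis using locally_increasing_top
        by (auto simp: side_positive_def cap_def refl_line_def gap_def)
    next
      case 3
      then show ?thesis using symmetric_increasing[of s0] locally_increasing_pos[of s0]
        by (auto simp: symmetric_increasing_def)
    qed
    then show "\<exists>\<eta>>0. \<forall>s k. \<bar>s - s0\<bar> < \<eta> \<longrightarrow> 0 \<le> k \<longrightarrow> k < \<eta> \<longrightarrow> side_positive s k"
      using side_positive_near[OF s0] by blast
  qed simp
  then obtain \<delta>0 where \<delta>0: "\<delta>0 > 0" "\<And>s k. 0 \<le> s \<Longrightarrow> s \<le> 1 \<Longrightarrow> 0 \<le> k \<Longrightarrow> k < \<delta>0 \<Longrightarrow> side_positive s k"
    by blast
  define \<delta> where "\<delta> = min (\<delta>0 / 2) (1 / 2)"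
  have \<delta>: "0 < \<delta>" "\<delta> < \<delta>0" "\<delta> < 1" using \<delta>0 by (auto simp: \<delta>_def)
  have "refl_diff \<delta> 1 x \<ge> 0" if x: "x \<in> cap \<delta> 1" for x
  proof (rule sweep_upwards)
    note s = cap_snd[OF x]
    have "2 * gap \<delta> 1 x / (1 + \<delta>\<^sup>2) \<le> 1 - snd x" using s by (simp add: refl_line_def)
    then have "2 * gap \<delta> 1 x \<le> (1 - snd x) * (1 + \<delta>\<^sup>2)"
      using one_plus_square_pos[of \<delta>] by (simp add: pos_divide_le_eq)
    then have "2 * \<delta> * fst x \<le> (1 - snd x) * (\<delta>\<^sup>2 - 1)" by (simp add: gap_def algebra_simps)
    also have "\<dots> \<le> 0" using s \<delta> by (intro mult_nonneg_nonpos) (auto simp: power_le_one)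
    finally show "fst x \<le> 0" using \<delta> by (simp add: mult_le_0_iff)
  qed (use \<delta> \<delta>0 x in auto)
  with \<delta>(1) show thesis by (rule that)
qed

text \<open>Swept from the triangle with slope \<delta> and intercept 1. The cut b is to the right
  of all triangles on the way, so the condition on the cut holds vacuously.\<close>

lemma refl_diff_nonneg:
  assumes k: "k > 0" and x: "x \<in> cap k d"
  shows "refl_diff k d x \<ge> 0"
proof -
  obtain \<delta> where \<delta>: "\<delta> > 0" "\<And>x. x \<in> cap \<delta> 1 \<Longrightarrow> refl_diff \<delta> 1 x \<ge> 0" by (rule full_triangle) blast
  define kmin where "kmin = min \<delta> k"
  define kmax where "kmax = max \<delta> k"
  define b where "b = ((1 + kmax\<^sup>2) / 2 + (1 + \<bar>d\<bar>) + 1) / kmin + 1"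
  have kmin: "kmin > 0" using \<delta> k by (simp add: kmin_def)
  have bound: "fst y < b" if "0 \<le> t" "t \<le> 1" "y \<in> cap (\<delta> + t * (k - \<delta>)) (1 + t * (d - 1))" for t y
  proof -
    have "(1 - t) * kmin \<le> (1 - t) * \<delta>" "t * kmin \<le> t * k"
      "(1 - t) * \<delta> \<le> (1 - t) * kmax" "t * k \<le> t * kmax"
      using that by (auto intro!: mult_left_mono simp: kmin_def kmax_def)
    then have 1: "kmin \<le> \<delta> + t * (k - \<delta>)" "\<delta> + t * (k - \<delta>) \<le> kmax" by (auto simp: algebra_simps)
    have "\<bar>(1 - t) + t * d\<bar> \<le> \<bar>1 - t\<bar> + \<bar>t * d\<bar>" by (rule abs_triangle_ineq)
    also have "\<bar>t * d\<bar> \<le> \<bar>d\<bar>" using that by (auto simp: abs_mult intro!: mult_left_le_one_le)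
    also have "\<bar>1 - t\<bar> \<le> 1" using that by simp
    finally have "\<bar>1 + t * (d - 1)\<bar> \<le> 1 + \<bar>d\<bar>" by (simp add: algebra_simps)
    from cap_bounded_right[OF kmin 1 this that(3)] show ?thesis by (simp add: b_def)
  qed
  show ?thesis
  proof (rule sweep[where ?k0.0 = \<delta> and ?k1.0 = k and ?d0.0 = 1 and ?d1.0 = d and b = b])
    show "fst x \<le> b" using bound[of 1 x] x by simp
    fix t y assume "0 \<le> t" "t \<le> 1" "y \<in> cap (\<delta> + t * (k - \<delta>)) (1 + t * (d - 1))" "fst y = b"
    then show "refl_diff (\<delta> + t * (k - \<delta>)) (1 + t * (d - 1)) y > 0" using bound[of t y] by simp
  qed (use \<delta> k x in auto)
qed

text \<open>
  Reflection in the lines of slope \<open>1 / h\<close> through \<open>(\<beta>, 0)\<close> tends to reflection in \<open>x\<^sub>1 = \<beta>\<close> as \<open>h\<close> tends to 0.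
\<close>

lemma antitone:
  assumes "a < b" "0 < y" "y < 1"
  shows "u (b, y) \<le> u (a, y)"
proof -
  define p where "p = (b - a) / 2"
  define \<beta> where "\<beta> = (a + b) / 2"
  have p: "p > 0" "b - \<beta> = p" using assms by (auto simp: p_def \<beta>_def field_simps)
  define F where "F = at_right (0 :: real)"
  have F_pos: "\<forall>\<^sub>F h in F. h > 0" unfolding F_def by (rule eventually_at_right_less)
  have lim: "((\<lambda>h. h) \<longlongrightarrow> 0) F" by (simp add: F_def tendsto_ident_at)
  have gap: "gap (1 / h) (- \<beta> / h) (b, y) = (p - h * y) / h" if "h > 0" for h
    using that by (simp add: gap_def diff_divide_distrib flip: p(2))
  \<comment> \<open>The image of (b, y) with the powers of 1 / h cleared; the formula makes sense at
    h = 0, where it gives (a, y).\<close>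
  define r where "r = (\<lambda>h. (b - 2 * (p - h * y) / (1 + h\<^sup>2), y + 2 * h * (p - h * y) / (1 + h\<^sup>2)))"
  have r: "refl_line (1 / h) (- \<beta> / h) (b, y) = r h" if "h > 0" for h
  proof -
    have *: "1 + (1 / h)\<^sup>2 = (1 + h\<^sup>2) / h\<^sup>2" using that by (simp add: field_simps)
    show ?thesis unfolding refl_line_def gap[OF that] r_def * using that
      by (simp add: power2_eq_square)
  qed
  have "(r \<longlongrightarrow> (b - 2 * (p - 0 * y) / (1 + 0\<^sup>2), y + 2 * 0 * (p - 0 * y) / (1 + 0\<^sup>2))) F"
    unfolding r_def by (intro tendsto_intros lim) auto
  moreover have "b - 2 * (p - 0 * y) / (1 + 0\<^sup>2) = a" by (simp add: p_def field_simps)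
  ultimately have lim_r: "(r \<longlongrightarrow> (a, y)) F" by simp
  have "((\<lambda>h. p - h * y) \<longlongrightarrow> p - 0 * y) F" by (intro tendsto_intros lim)
  then have "\<forall>\<^sub>F h in F. p - h * y > 0" by (rule order_tendstoD) (use p in simp)
  moreover have "\<forall>\<^sub>F h in F. snd (r h) < 1" "\<forall>\<^sub>F h in F. snd (r h) > 0"
    using order_tendstoD[OF tendsto_snd[OF lim_r]] assms by auto
  ultimately have ev: "\<forall>\<^sub>F h in F. u (r h) \<ge> u (b, y) \<and> 0 < snd (r h) \<and> snd (r h) < 1"
    using F_pos
  proof eventually_elim
    case (elim h)
    have "(b, y) \<in> cap (1 / h) (- \<beta> / h)" unfolding cap_def mem_Collect_eq gap[OF elim(4)] r[OF elim(4)]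
      using elim assms by auto
    from refl_diff_nonneg[OF _ this, unfolded refl_diff_def r[OF elim(4)]] show ?case using elim by simp
  qed
  have "((\<lambda>h. u (r h)) \<longlongrightarrow> u (a, y)) F"
    using ev assms by (intro continuous_on_tendsto_compose[OF cont(1) lim_r])
      (auto simp: mem_Times_iff elim!: eventually_mono)
  then show ?thesis
    by (rule tendsto_lowerbound) (use ev in \<open>auto elim: eventually_mono simp: F_def\<close>)
qed

end

lemma (in strip_solution) independent_of_first:
  assumes "0 \<le> y" "y \<le> 1"
  shows "u (a, y) = u (b, y)"
proof -
  interpret m: strip_solution f c L "\<lambda>x. u (- fst x, snd x)" "\<lambda>x. - g1 (- fst x, snd x)" "\<lambda>x. g2 (- fst x, snd x)"
    "\<lambda>x. g11 (- fst x, snd x)" "\<lambda>x. - g12 (- fst x, snd x)" "\<lambda>x. - g21 (- fst x, snd x)" "\<lambda>x. g22 (- fst x, snd x)"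
    by (rule mirror)
  have *: "u (a, y) = u (b, y)" if "a < b" "0 < y" "y < 1" for a b
    using antitone[OF that] m.antitone[of "- b" "- a" y] that by simp
  consider "y = 0" | "y = 1" | "0 < y" "y < 1" using assms by linarith
  then show ?thesis
  proof cases
    case 3
    then show ?thesis using *[of a b] *[of b a, symmetric] by (cases a b rule: linorder_cases) auto
  qed (simp_all add: bottom top)
qed

lemma (in strip_solution) has_derivative_vertical:
  assumes "0 < y" "y < 1"
  shows "((\<lambda>y. u (0, y)) has_real_derivative g2 (0, y)) (at y)" "g2 (0, y) > 0"
proof -
  have "(u has_derivative (\<lambda>h. g1 (0, y) * fst h + g2 (0, y) * snd h)) (at (0 + y * 0, 0 + y * 1))"
    using deriv_u[of "(0, y)"] assms by simp
  from has_derivative_along_line[OF this]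
  show "((\<lambda>y. u (0, y)) has_real_derivative g2 (0, y)) (at y)" by simp
  show "g2 (0, y) > 0" using symmetric_increasing[OF assms] by (simp add: symmetric_increasing_def)
qed

section \<open>From vectors to pairs\<close>

definition pt :: "real \<times> real \<Rightarrow> real ^ 2"
  where "pt p = vector [fst p, snd p]"

lemma pt_nth [simp]: "pt p $ 1 = fst p" "pt p $ 2 = snd p"
  by (simp_all add: pt_def)

lemma pt_components: "pt (x $ 1, x $ 2) = x"
  by (simp add: vec_eq_iff forall_2)

lemma pt_plus_axis: "pt p + t *\<^sub>R axis 1 1 = pt (fst p + t, snd p)" "pt p + t *\<^sub>R axis 2 1 = pt (fst p, snd p + t)"
  by (simp_all add: vec_eq_iff forall_2 axis_def)

lemma continuous_on_pt: "continuous_on A pt"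
proof -
  have *: "pt = (\<lambda>p. fst p *\<^sub>R axis 1 1 + snd p *\<^sub>R axis 2 1)"
    by (simp add: fun_eq_iff vec_eq_iff forall_2 axis_def)
  show ?thesis unfolding * by (intro continuous_intros)
qed

lemma pt_in_strip: "pt p \<in> strip \<longleftrightarrow> 0 < snd p \<and> snd p < 1"
  by (simp add: strip_def)

lemma closed_strip_subset_closure:
  assumes "0 \<le> x $ 2" "x $ 2 \<le> 1"
  shows "x \<in> closure strip"
  unfolding closure_approachable
proof (intro allI impI)
  fix e :: real assume e: "e > 0"
  define t where "t = min (1/2) (e/2)"
  have t: "0 < t" "t < 1" "t < e" using e by (auto simp: t_def)
  \<comment> \<open>Moves x by the fraction t of its way to the midline, into the open
    strip.\<close>
  define y where "y = x + (t * (1/2 - x $ 2)) *\<^sub>R axis 2 1"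
  define z where "z = (1 - t) * (x $ 2)"
  have "y $ 2 = z + t / 2" by (simp add: y_def z_def axis_def algebra_simps)
  moreover have "z \<ge> 0" using t assms by (simp add: z_def)
  moreover have "z \<le> (1 - t) * 1" unfolding z_def using t assms by (intro mult_left_mono) auto
  ultimately have "0 < y $ 2" "y $ 2 < 1" using t by auto
  then have "y \<in> strip" by (simp add: strip_def)
  moreover have "dist y x < e"
  proof -
    have "dist y x = t * \<bar>1/2 - x $ 2\<bar>" using t by (simp add: y_def dist_norm abs_mult)
    also have "\<dots> \<le> t * 1" using assms t by (intro mult_left_mono) (auto simp: abs_if)
    finally show ?thesis using t by simp
  qed
  ultimately show "\<exists>y\<in>strip. dist y x < e" by blast
qed

lemma closure_strip: "closure strip = {x. 0 \<le> x $ 2 \<and> x $ 2 \<le> 1}"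
proof
  have "closed {x :: real ^ 2. 0 \<le> x $ 2 \<and> x $ 2 \<le> 1}"
    by (intro closed_Collect_conj closed_Collect_le continuous_intros)
  then show "closure strip \<subseteq> {x. 0 \<le> x $ 2 \<and> x $ 2 \<le> 1}"
    by (intro closure_minimal) (auto simp: strip_def)
qed (auto intro: closed_strip_subset_closure)

lemma continuous_on_pt_strip:
  assumes "continuous_on (closure strip) v"
  shows "continuous_on (UNIV \<times> {0..1}) (\<lambda>p. v (pt p))"
  by (rule continuous_on_compose2[OF assms continuous_on_pt]) (auto simp: closure_strip)

text \<open>The hypotheses give derivatives along the axes only; continuity of the second one makes
  the function totally differentiable. The open strip is treated as the product of the line and (0,
  1).\<close>

lemma has_derivative_of_partials:
  fixes v A B :: "real ^ 2 \<Rightarrow> real"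
  assumes 1: "\<And>x. x \<in> strip \<Longrightarrow> (line_through v 1 x has_real_derivative A x) (at 0)"
    and 2: "\<And>x. x \<in> strip \<Longrightarrow> (line_through v 2 x has_real_derivative B x) (at 0)"
    and B: "continuous_on (closure strip) B"
    and p: "0 < snd p" "snd p < 1"
  shows "((\<lambda>p. v (pt p)) has_derivative (\<lambda>h. A (pt p) * fst h + B (pt p) * snd h)) (at p)"
proof -
  define fy where "fy = (\<lambda>x y. B (pt (x, y)) *\<^sub>R (id_blinfun :: real \<Rightarrow>\<^sub>L real))"
  have fy: "blinfun_apply (fy x y) = (*) (B (pt (x, y)))" for x y
    by (simp add: fy_def fun_eq_iff blinfun.scaleR_left)
  have "((\<lambda>(x, y). v (pt (x, y))) has_derivative (\<lambda>(tx, ty). A (pt p) * tx + fy (fst p) (snd p) ty))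
      (at (fst p, snd p) within UNIV \<times> {0<..<1})"
  proof (rule has_derivative_partialsI)
    have "(line_through v 1 (pt p) has_real_derivative A (pt p)) (at 0)"
      using p by (intro 1) (simp add: pt_in_strip)
    then have "((\<lambda>t. v (pt (fst p + t, snd p))) has_real_derivative A (pt p)) (at 0)"
      unfolding line_through_def pt_plus_axis .
    then have "((\<lambda>t. v (pt (t, snd p))) has_real_derivative A (pt p)) (at (fst p))"
      using DERIV_shift[of "\<lambda>t. v (pt (t, snd p))" "A (pt p)" 0 "fst p"] by (simp add: add.commute)
    then show "((\<lambda>t. v (pt (t, snd p))) has_derivative (*) (A (pt p))) (at (fst p))"
      by (simp add: has_field_derivative_def)
  next
    fix x y :: real assume y: "y \<in> {0<..<1}"
    have "(line_through v 2 (pt (x, y)) has_real_derivative B (pt (x, y))) (at 0)"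
      using y by (intro 2) (simp add: pt_in_strip)
    then have "((\<lambda>t. v (pt (x, y + t))) has_real_derivative B (pt (x, y))) (at 0)"
      unfolding line_through_def pt_plus_axis by simp
    then have "((\<lambda>t. v (pt (x, t))) has_real_derivative B (pt (x, y))) (at y)"
      using DERIV_shift[of "\<lambda>t. v (pt (x, t))" "B (pt (x, y))" 0 y] by (simp add: add.commute)
    then show "((\<lambda>t. v (pt (x, t))) has_derivative blinfun_apply (fy x y)) (at y within {0<..<1})"
      unfolding fy by (simp add: has_field_derivative_def has_derivative_at_withinI)
  next
    have "continuous_on (UNIV \<times> {0<..<1}) (\<lambda>p. B (pt p))"
      by (rule continuous_on_subset[OF continuous_on_pt_strip[OF B]]) auto
    then have "continuous_on (UNIV \<times> {0<..<1}) (\<lambda>(x, y). fy x y)"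
      unfolding fy_def by (auto simp: case_prod_unfold intro!: continuous_intros)
    then show "continuous (at (fst p, snd p) within UNIV \<times> {0<..<1}) (\<lambda>(x, y). fy x y)"
      unfolding continuous_on_eq_continuous_within by (rule bspec) (use p in \<open>simp add: mem_Times_iff\<close>)
  qed (use p in auto)
  moreover have "at (fst p, snd p) within UNIV \<times> {0<..<1} = at p"
    using p by (subst at_within_open) (auto intro: open_Times simp: mem_Times_iff)
  ultimately show ?thesis by (simp add: case_prod_unfold fy)
qed

lemma line_through_eventually_in_strip:
  assumes "x \<in> strip"
  shows "\<forall>\<^sub>F t in nhds 0. x + t *\<^sub>R axis i 1 \<in> strip"
proof -
  have "((\<lambda>t. (x + t *\<^sub>R axis i 1) $ 2) \<longlongrightarrow> x $ 2) (nhds 0)"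
    by (rule tendsto_eq_intros refl filterlim_ident | simp)+
  from order_tendstoD[OF this] assms show ?thesis
    unfolding strip_def mem_Collect_eq by (intro eventually_conj) auto
qed

theorem theorem1p4:
  fixes f :: "real \<Rightarrow> real" and u :: "real ^ 2 \<Rightarrow> real" and c :: real
  assumes "locally_lipschitz f"
    and "C2_on_closure strip u"
    and "bounded (u ` closure strip)"
    and "\<forall>x\<in>strip. laplacian u x + f (u x) = 0"
    and "c > 0"
    and "\<forall>x. x $ 2 = 0 \<longrightarrow> u x = 0"
    and "\<forall>x. x $ 2 = 1 \<longrightarrow> u x = c"
    and "\<forall>x\<in>strip. 0 < u x \<and> u x < c"
  shows "\<exists>w :: real \<Rightarrow> real.
    (\<forall>x\<in>closure strip. u x = w (x $ 2)) \<and>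
    (\<forall>y. 0 < y \<and> y < 1 \<longrightarrow> (\<exists>D>0. (w has_real_derivative D) (at y)))"
proof -
  note C2 = assms(2)[unfolded C2_on_closure_def continuous_up_to_boundary_def]
  have "\<forall>i. \<exists>g. continuous_on (closure strip) g \<and> (\<forall>x\<in>strip. g x = partial i u x)" using C2 by blast
  then obtain g where g: "\<And>i. continuous_on (closure strip) (g i)" "\<And>i x. x \<in> strip \<Longrightarrow> g i x = partial i u x"
    by metis
  have "\<forall>i j. \<exists>h. continuous_on (closure strip) h \<and> (\<forall>x\<in>strip. h x = partial j (partial i u) x)" using C2 by blast
  then obtain h where h: "\<And>i j. continuous_on (closure strip) (h i j)"
      "\<And>i j x. x \<in> strip \<Longrightarrow> h i j x = partial j (partial i u) x"
    by metis
  have dg: "(line_through u i x has_real_derivative g i x) (at 0)" if x: "x \<in> strip" for i x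
  proof -
    have "line_through u i x differentiable (at 0)" using C2 x by (auto simp: has_partial_on_def)
    then show ?thesis using g(2)[OF x, of i] by (simp add: partial_def DERIV_deriv_iff_real_differentiable)
  qed
  have dh: "(line_through (g i) j x has_real_derivative h i j x) (at 0)" if x: "x \<in> strip" for i j x
  proof -
    have "line_through (partial i u) j x differentiable (at 0)" using C2 x by (auto simp: has_partial_on_def)
    then have "(line_through (partial i u) j x has_real_derivative h i j x) (at 0)"
      using h(2)[OF x, of i j] by (simp add: partial_def[of j] DERIV_deriv_iff_real_differentiable)
    \<comment> \<open>The extension \<open>g i\<close> is known to agree with
      \<open>partial i u\<close> on the open strip only, but that contains the axis line through x
      near t = 0.\<close>
    moreover have "\<forall>\<^sub>F t in nhds 0. line_through (g i) j x t = line_through (partial i u) j x t"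
      using line_through_eventually_in_strip[OF x, of j]
      by eventually_elim (simp add: line_through_def g(2))
    ultimately show ?thesis by (subst DERIV_cong_ev[OF refl _ refl])
  qed
  have "local_lipschitz UNIV UNIV (\<lambda>_ :: real. f)" using assms(1) by (simp add: locally_lipschitz_def)
  \<comment> \<open>Compactness of [0, c] turns the local condition into one Lipschitz constant L0;
    \<open>\<bar>L0\<bar> + 1\<close> below makes it positive.\<close>
  then have "local_lipschitz {0 :: real} {0..c} (\<lambda>_. f)" by (rule local_lipschitz_subset) auto
  then obtain L0 where L0: "\<And>t. t \<in> {0 :: real} \<Longrightarrow> L0-lipschitz_on {0..c} f"
    by (rule local_lipschitz_compact_implies_lipschitz) auto
  interpret s: strip_solution f c "\<bar>L0\<bar> + 1" "\<lambda>p. u (pt p)" "\<lambda>p. g 1 (pt p)" "\<lambda>p. g 2 (pt p)"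
    "\<lambda>p. h 1 1 (pt p)" "\<lambda>p. h 1 2 (pt p)" "\<lambda>p. h 2 1 (pt p)" "\<lambda>p. h 2 2 (pt p)"
  proof
    fix x :: "real \<times> real" assume x: "0 < snd x" "snd x < 1"
    then have xs: "pt x \<in> strip" by (simp add: pt_in_strip)
    show "h 1 1 (pt x) + h 2 2 (pt x) + f (u (pt x)) = 0"
      using assms(4) xs by (simp add: laplacian_def sum_2 h(2))
    show "0 < u (pt x) \<and> u (pt x) < c" using assms(8) xs by blast
  next
    fix a b assume ab: "a \<in> {0..c}" "b \<in> {0..c}"
    have "\<bar>f a - f b\<bar> \<le> L0 * \<bar>a - b\<bar>" using lipschitz_onD[OF L0[OF singletonI] ab] by (simp add: dist_real_def)
    also have "\<dots> \<le> (\<bar>L0\<bar> + 1) * \<bar>a - b\<bar>" by (intro mult_right_mono) auto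
    finally show "\<bar>f a - f b\<bar> \<le> (\<bar>L0\<bar> + 1) * \<bar>a - b\<bar>" .
  next
    show "continuous_on (UNIV \<times> {0..1}) (\<lambda>p. u (pt p))" using C2 by (intro continuous_on_pt_strip) blast
  qed (use assms(5-7) in \<open>auto intro!: continuous_on_pt_strip g(1) h(1) has_derivative_of_partials dg dh\<close>)
  show ?thesis
  proof (intro exI[of _ "\<lambda>y. u (pt (0, y))"] conjI ballI allI impI)
    fix x :: "real ^ 2" assume "x \<in> closure strip"
    then show "u x = u (pt (0, x $ 2))"
      using s.independent_of_first[of "x $ 2" "x $ 1" 0] by (simp add: closure_strip pt_components)
  next
    fix y :: real assume "0 < y \<and> y < 1"
    then show "\<exists>D>0. ((\<lambda>y. u (pt (0, y))) has_real_derivative D) (at y)"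
      using s.has_derivative_vertical[of y] by blast
  qed
qed

end
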